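(* Let $d\ge2$ and let $\Pi$ be an arbitrary $\mathbf 0$-symmetric parallelepiped in $\mathbb R^d$, with pseudo-compound parallelepiped $\Pi^\ast$. Then for each $d$-tuple $\boldsymbol\tau=(\tau_1,\ldots,\tau_d)$ of positive real numbers such that \[ \sum_{i=1}^d\tau_i^2=\prod_{i=1}^d\tau_i^2 \] we have \[ \mu_1(\Pi^\ast,\mathbb Z^d)\le1\ \Longrightarrow\ \mu_1(\mathrm H_{\boldsymbol\tau}\Pi,\mathbb Z^d)\le1. \]
   Context: Successive minima: for a convex body $M\subset\mathbb R^d$ symmetric with respect to the origin and a $d$-dimensional (full rank) lattice $\Lambda\subset\mathbb R^d$, the $k$-th successive minimum $\mu_k(M,\Lambda)$ is the minimal positive $\mu$ such that $\mu M$ contains $k$ linearly independent points of $\Lambda$. Pseudo-compound parallelepiped: every $\mathbf 0$-symmetric (closed, non-degenerate) parallelepiped in $\mathbb R^d$ can be written as $\Pi=\{\mathbf z\in\mathbb R^d : |h_i(\mathbf z)|\le\eta_i,\ i=1,\ldots,d\}$ with positive numbers $\eta_1,\ldots,\eta_d$ and linear forms $h_1,\ldots,h_d$ on $\mathbb R^d$ whose coefficient matrix $H$ (rows are the forms) has $\det H=1$. Let $h_1^\ast,\ldots,h_d^\ast$ be the dual set of linear forms, i.e. $\langle h_i,h_j^\ast\rangle=\delta_{ij}$ where forms are identified with their coefficient vectors and $\langle\cdot,\cdot\rangle$ is the standard inner product. The pseudo-compound of $\Pi$ is \[ \Pi^\ast=\Big\{\mathbf z\in\mathbb R^d : |h_i^\ast(\mathbf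 z)|\le\frac1{\eta_i}\prod_{j=1}^d\eta_j,\ i=1,\ldots,d\Big\}. \] The operators $\mathrm H_{\boldsymbol\tau}$: fix an operator $\mathrm A_\Pi\in\mathrm{GL}_d(\mathbb R)$ with $\mathrm A_\Pi\Pi=[-1,1]^d$. For $\boldsymbol\tau=(\tau_1,\ldots,\tau_d)\in\mathbb R_{>0}^d$ set $\mathrm H_{\boldsymbol\tau}=\mathrm H_{\boldsymbol\tau,\Pi}=\mathrm A_\Pi^{-1}\,\mathrm{diag}(\tau_1,\ldots,\tau_d)\,\mathrm A_\Pi$. *)

theory Defs
  imports "HOL-Analysis.Analysis"
begin

text \<open>The space \<open>\<real>\<^sup>d\<close> is \<open>real ^ 'n\<close> with \<open>d = CARD('n)\<close>.\<close>

definition integer_lattice :: "(real ^ 'n) set" where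
  "integer_lattice = {x. \<forall>i. x $ i \<in> \<int>}"

definition unit_cube :: "(real ^ 'n) set" where
  "unit_cube = {x. \<forall>i. \<bar>x $ i\<bar> \<le> 1}"

definition diagonal_matrix :: "real ^ 'n \<Rightarrow> real ^ 'n ^ 'n" where
  "diagonal_matrix t = (\<chi> i j. if i = j then t $ i else 0)"

text \<open>
  The minimum exists when \<open>M\<close> is a symmetric convex body, \<open>L\<close> is a full rank lattice
  and \<open>1 \<le> k \<le> CARD('n)\<close>; outside this range the value carries no meaning.
\<close>

definition successive_minimum ::
    "nat \<Rightarrow> (real ^ 'n) set \<Rightarrow> (real ^ 'n) set \<Rightarrow> real" where
  "successive_minimum k M L =
     (LEAST m. 0 < m \<and> (\<exists>S. S \<subseteq> (*\<^sub>R) m ` M \<inter> L \<and> card S = k \<and> independent S))"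

definition symmetric_parallelepiped :: "(real ^ 'n) set \<Rightarrow> bool" where
  "symmetric_parallelepiped P \<longleftrightarrow>
     (\<exists>v :: 'n \<Rightarrow> real ^ 'n. inj v \<and> independent (range v) \<and>
        P = {\<Sum>i\<in>UNIV. t i *\<^sub>R v i | t. \<forall>i. \<bar>t i\<bar> \<le> 1})"

text \<open>A linear form is identified with its coefficient vector, so \<open>h(z) = h \<bullet> z\<close>.\<close>

definition form_box :: "('n \<Rightarrow> real ^ 'n) \<Rightarrow> ('n \<Rightarrow> real) \<Rightarrow> (real ^ 'n) set" where
  "form_box h c = {z. \<forall>i. \<bar>h i \<bullet> z\<bar> \<le> c i}"

definition dual_forms :: "('n \<Rightarrow> real ^ 'n) \<Rightarrow> ('n \<Rightarrow> real ^ 'n) \<Rightarrow> bool" where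
  "dual_forms h h' \<longleftrightarrow> (\<forall>i j. h i \<bullet> h' j = (if i = j then 1 else 0))"

text \<open>
  \<open>pseudo_compound P Q\<close> says that \<open>Q\<close> is the pseudo-compound computed from some
  normalised presentation of \<open>P\<close>. Two presentations differ only by the order of the forms
  and by replacing \<open>h i\<close>, \<open>\<eta> i\<close> with \<open>c i *\<^sub>R h i\<close>, \<open>\<bar>c i\<bar> * \<eta> i\<close>, where the product of the \<open>c i\<close> is
  \<open>1\<close> or \<open>-1\<close>; this does not affect \<open>Q\<close>, so \<open>Q\<close> is unique. Existence is proved below.
\<close>

definition pseudo_compound :: "(real ^ 'n) set \<Rightarrow> (real ^ 'n) set \<Rightarrow> bool" where
  "pseudo_compound P Q \<longleftrightarrow>
     (\<exists>h h' \<eta>. det (\<chi> i. h i) = 1 \<and> (\<forall>i. 0 < \<eta> i) \<and> P = form_box h \<eta> \<and>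
        dual_forms h h' \<and> Q = form_box h' (\<lambda>i. 1 / \<eta> i * (\<Prod>j\<in>UNIV. \<eta> j)))"

definition H_op :: "real ^ 'n ^ 'n \<Rightarrow> real ^ 'n \<Rightarrow> real ^ 'n ^ 'n" where
  "H_op A t = matrix_inv A ** diagonal_matrix t ** A"

lemma symmetric_parallelepiped_unit_cube:
  fixes P :: "(real ^ 'n) set"
  assumes "symmetric_parallelepiped P"
  obtains A :: "real ^ 'n ^ 'n"
  where "invertible A" and "(*v) A ` P = unit_cube" and "P = {z. A *v z \<in> unit_cube}"
proof -
  obtain v :: "'n \<Rightarrow> real ^ 'n" where v: "inj v" "independent (range v)"
    and P: "P = {\<Sum>i\<in>UNIV. t i *\<^sub>R v i | t. \<forall>i. \<bar>t i\<bar> \<le> 1}"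
    using assms unfolding symmetric_parallelepiped_def by blast
  define V :: "real ^ 'n ^ 'n" where "V = (\<chi> i j. v j $ i)"
  have col: "column i V = v i" for i
    by (simp add: V_def column_def vec_eq_iff)
  have Vx: "V *v x = (\<Sum>i\<in>UNIV. x $ i *\<^sub>R v i)" for x
    by (simp add: matrix_mult_sum col scalar_mult_eq_scaleR)
  have "\<forall>c. (\<Sum>i\<in>UNIV. c i *s column i V) = 0 \<longrightarrow> (\<forall>i. c i = 0)"
  proof (intro allI impI)
    fix c i
    assume 0: "(\<Sum>i\<in>UNIV. c i *s column i V) = 0"
    have "(\<Sum>w\<in>range v. c (inv v w) *\<^sub>R w) = (\<Sum>i\<in>UNIV. c i *\<^sub>R v i)"
      using v(1) by (subst sum.reindex) auto
    also have "\<dots> = 0"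
      using 0 by (simp add: col scalar_mult_eq_scaleR)
    finally have "c (inv v (v i)) = 0"
      using v(2) independentD[of "range v" "range v" "\<lambda>w. c (inv v w)" "v i"] by auto
    then show "c i = 0"
      using v(1) by simp
  qed
  then obtain A where A: "A ** V = mat 1"
    using matrix_left_invertible_independent_columns[of V] by blast
  then have VA: "V ** A = mat 1"
    by (simp add: matrix_left_right_inverse)
  have AV': "A *v (V *v x) = x" and VA': "V *v (A *v x) = x" for x
    using A VA by (simp_all add: matrix_vector_mul_assoc)
  have PV: "P = (*v) V ` unit_cube"
  proof (intro set_eqI iffI)
    fix z assume "z \<in> P"
    then obtain t where t: "z = (\<Sum>i\<in>UNIV. t i *\<^sub>R v i)" "\<forall>i. \<bar>t i\<bar> \<le> 1"
      unfolding P by blast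
    then have "z = V *v (\<chi> i. t i)" "(\<chi> i. t i) \<in> unit_cube"
      by (simp_all add: Vx unit_cube_def)
    then show "z \<in> (*v) V ` unit_cube"
      by blast
  next
    fix z assume "z \<in> (*v) V ` unit_cube"
    then obtain x where "z = V *v x" "x \<in> unit_cube"
      by blast
    then show "z \<in> P"
      unfolding P Vx unit_cube_def by auto
  qed
  show ?thesis
  proof
    show "invertible A"
      using A VA unfolding invertible_def by blast
    show "(*v) A ` P = unit_cube"
      unfolding PV by (simp add: image_image AV')
    show "P = {z. A *v z \<in> unit_cube}"
      unfolding PV using AV' VA' by (auto simp: image_iff) metis
  qed
qed

lemma pseudo_compound_exists:
  fixes P :: "(real ^ 'n) set"
  assumes "symmetric_parallelepiped P"
  shows "\<exists>Q. pseudo_compound P Q"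
proof -
  obtain A :: "real ^ 'n ^ 'n" where inv: "invertible A" and P: "P = {z. A *v z \<in> unit_cube}"
    using symmetric_parallelepiped_unit_cube[OF assms] by metis
  define k :: 'n where "k = undefined"
  define c where "c i = (if i = k then inverse (det A) else 1)" for i
  define h where "h i = c i *s A $ i" for i
  define \<eta> where "\<eta> i = \<bar>c i\<bar>" for i
  have detA: "det A \<noteq> 0"
    using inv by (simp add: invertible_det_nz)
  then have cnz: "c i \<noteq> 0" for i
    by (simp add: c_def)
  then have pos: "\<forall>i. 0 < \<eta> i"
    by (simp add: \<eta>_def)
  have "det (\<chi> i. h i) = prod c UNIV * det A"
    unfolding h_def by (subst det_rows_mul) simp
  also have "prod c UNIV = inverse (det A)"
    unfolding c_def by simp
  finally have det: "det (\<chi> i. h i) = 1"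
    using detA by simp
  have "P = form_box h \<eta>"
    using cnz unfolding P unit_cube_def form_box_def h_def \<eta>_def
    by (simp add: matrix_vector_mul_component scalar_mult_eq_scaleR abs_mult)
  moreover obtain h' where "dual_forms h h'"
  proof -
    obtain B where B: "(\<chi> i. h i) ** B = mat 1"
      using det invertible_det_nz[of "\<chi> i. h i"] unfolding invertible_def by auto
    have "((\<chi> i. h i) ** B) $ i $ j = h i \<bullet> column j B" for i j
      by (simp add: matrix_matrix_mult_def inner_vec_def column_def)
    then have "dual_forms h (\<lambda>j. column j B)"
      unfolding dual_forms_def B by (simp add: mat_def)
    then show ?thesis
      by (rule that)
  qed
  ultimately show ?thesis
    unfolding pseudo_compound_def using det pos by blast
qed

end

theory Submission
  imports Defs
begin

text \<open>
  The transference is Minkowski's convex body theorem on a hyperplane. Let \<open>v\<close> be a nonzero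
  integer point of \<open>\<Pi>\<^sup>*\<close>, and use coordinates \<open>u = L z\<close> in which \<open>H\<^sub>\<tau> \<Pi>\<close> is the cube
  \<open>[-1, 1]\<^sup>d\<close>. The integer lattice becomes \<open>\<Lambda> = L \<int>\<^sup>d\<close>, of covolume \<open>M = \<bar>det L\<bar>\<close>, and the form
  \<open>v \<bullet> z\<close> becomes \<open>w \<bullet> u\<close>, which is integral on \<open>\<Lambda>\<close>. The definition of \<open>\<Pi>\<^sup>*\<close> bounds the \<open>i\<close>-th
  entry of \<open>w\<close> by \<open>\<tau>\<^sub>i \<Prod>\<^sub>j \<eta>\<^sub>j\<close>, while \<open>M = 1 / \<Prod>\<^sub>j (\<eta>\<^sub>j \<tau>\<^sub>j)\<close>. Hence the hypothesis
  \<open>\<Sum> \<tau>\<^sub>i\<^sup>2 = \<Prod> \<tau>\<^sub>i\<^sup>2\<close> yields exactly \<open>M |w| \<le> 1\<close>: for primitive \<open>v\<close>, the hyperplane section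
  \<open>\<Lambda> \<inter> w\<^sup>\<bottom>\<close> has covolume at most \<open>1\<close>. A nonzero point of \<open>\<Lambda> \<inter> w\<^sup>\<bottom>\<close> in the cube is wanted.

  Since every central hyperplane section of \<open>[-1/2, 1/2]\<^sup>d\<close> has volume at least \<open>1\<close> (Hadwiger,
  Hensley, Vaaler), Minkowski's theorem in \<open>w\<^sup>\<bottom>\<close> would finish the proof. Both ingredients are
  replaced by one averaging argument. Suppose that the translates of a cube \<open>K\<close> of side
  \<open>2 q\<close> by \<open>\<Lambda> \<inter> w\<^sup>\<bottom>\<close> are disjoint. Then the image of Lebesgue measure on \<open>K\<close> under \<open>x \<mapsto> w \<bullet> x\<close>
  has density at most \<open>M\<close> (\<open>nn_integral_along_functional_le\<close>). A measure of total mass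
  \<open>V = (2 q)\<^sup>d\<close> with density at most \<open>M\<close> has second moment at least \<open>V\<^sup>3 / (12 M\<^sup>2)\<close>, whereas a direct
  computation gives \<open>V q\<^sup>2 |w|\<^sup>2 / 3\<close> (\<open>nn_integral_cube_inner_square\<close>). So \<open>V \<le> M |w| 2 q \<le> 2 q\<close>
  (\<open>packed_cube_functional_bound\<close>), which for \<open>d \<ge> 2\<close> fails as soon as \<open>2 q > 1\<close>. If the closed
  cube contained no nonzero point of \<open>\<Lambda> \<inter> w\<^sup>\<bottom>\<close>, discreteness would allow such a \<open>q\<close>
  (\<open>central_section_lattice_point\<close>).

  The operator \<open>A\<close> in \<open>H\<^sub>\<tau>\<close> and the forms \<open>h\<^sub>i\<close> are two independent descriptions of \<open>\<Pi>\<close>; they differ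
  by a linear automorphism of the cube, that is, by a signed permutation (\<open>cube_automorphism\<close>).
\<close>

section \<open>Linear maps and Lebesgue measure\<close>

lemma nn_integral_lborel_translate:
  fixes f :: "'a::euclidean_space \<Rightarrow> ennreal"
  assumes [measurable]: "f \<in> borel_measurable borel"
  shows "(\<integral>\<^sup>+x. f (x + a) \<partial>lborel) = (\<integral>\<^sup>+x. f x \<partial>lborel)"
proof -
  have "(\<integral>\<^sup>+x. f x \<partial>lborel) = (\<integral>\<^sup>+x. f x \<partial>distr lborel borel ((+) a))"
    by (simp add: lborel_distr_plus)
  also have "\<dots> = (\<integral>\<^sup>+x. f (x + a) \<partial>lborel)"
    by (subst nn_integral_distr) (simp_all add: add.commute)
  finally show ?thesis ..
qed

definition reference_cube :: "(real ^ 'n) set" where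
  "reference_cube = {x. \<forall>i. \<bar>x $ i\<bar> \<le> 1 / 2}"

text \<open>
  The factor by which \<open>A\<close> shrinks volumes, read off from the preimage of a single cube. It
  turns out to be \<open>1 / \<bar>det A\<bar>\<close>.
\<close>

definition modulus :: "real ^ 'n ^ 'n \<Rightarrow> ennreal" where
  "modulus A = (\<integral>\<^sup>+x. indicator reference_cube (A *v x) \<partial>lborel)"

lemma symmetric_cube_eq_cbox: "{x :: real ^ 'n. \<forall>i. \<bar>x $ i\<bar> \<le> r} = cbox (\<chi> i. - r) (\<chi> i. r)"
proof -
  have "(\<forall>i. \<bar>x $ i\<bar> \<le> r) \<longleftrightarrow> (\<forall>i. - r \<le> x $ i \<and> x $ i \<le> r)" for x :: "real ^ 'n"
    by (rule iff_allI) linarith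
  then show ?thesis
    by (auto simp: mem_box_cart)
qed

lemma emeasure_symmetric_cube:
  assumes "0 \<le> r"
  shows "emeasure lborel {x :: real ^ 'n. \<forall>i. \<bar>x $ i\<bar> \<le> r} = ennreal ((2 * r) ^ CARD('n))"
proof -
  define Q where "Q = cbox (\<chi> i. - r) ((\<chi> i. r) :: real ^ 'n)"
  have "emeasure lborel Q = ennreal (measure lborel Q)"
    using emeasure_lborel_cbox_finite[of "\<chi> i. - r" "(\<chi> i. r) :: real ^ 'n"]
    by (intro emeasure_eq_ennreal_measure) (auto simp: Q_def)
  also have "measure lborel Q = (2 * r) ^ CARD('n)"
    using assms by (simp add: Q_def content_cbox_if_cart interval_eq_empty_cart)
  finally show ?thesis
    by (simp add: Q_def symmetric_cube_eq_cbox)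
qed

lemma reference_cube_borel [measurable]: "reference_cube \<in> sets borel"
  by (simp add: reference_cube_def symmetric_cube_eq_cbox)

lemma emeasure_reference_cube: "emeasure lborel (reference_cube :: (real ^ 'n) set) = 1"
  unfolding reference_cube_def by (subst emeasure_symmetric_cube) simp_all

lemma matrix_vector_mult_single_entry:
  fixes A :: "real ^ 'n ^ 'm"
  assumes "\<And>j. j \<noteq> k \<Longrightarrow> A $ i $ j = 0"
  shows "(A *v x) $ i = A $ i $ k * x $ k"
proof -
  have "(A *v x) $ i = (\<Sum>j\<in>UNIV. A $ i $ j * x $ j)"
    by (simp add: matrix_vector_mult_def)
  also have "\<dots> = (\<Sum>j\<in>UNIV. if j = k then A $ i $ k * x $ k else 0)"
    by (rule sum.cong) (use assms in auto)
  finally show ?thesis by simp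
qed

lemma borel_measurable_matrix_vector_mult [measurable]:
  "(*v) (A :: real ^ 'n ^ 'm) \<in> borel \<rightarrow>\<^sub>M borel"
  by (intro borel_measurable_continuous_onI matrix_vector_mult_linear_continuous_on)

text \<open>
  Uniqueness of Haar measure for the image of Lebesgue measure under \<open>A\<close>, which is again
  translation invariant: integrate \<open>f (A x + y)\<close> over \<open>x\<close> and over \<open>y\<close> in the reference cube, and
  evaluate the double integral in both orders. The symmetry of the cube turns \<open>y - A x\<close> into
  \<open>A x - y\<close>.
\<close>

lemma nn_integral_matrix_modulus:
  fixes A :: "real ^ 'n ^ 'n" and f :: "real ^ 'n \<Rightarrow> ennreal"
  assumes "invertible A" and [measurable]: "f \<in> borel_measurable borel"
  shows "(\<integral>\<^sup>+x. f (A *v x) \<partial>lborel) = modulus A * (\<integral>\<^sup>+x. f x \<partial>lborel)"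
proof -
  let ?Q = "reference_cube :: (real ^ 'n) set"
  obtain B where AB: "A ** B = mat 1"
    using assms by (auto simp: invertible_def)
  have shift: "(\<integral>\<^sup>+x. F (A *v x + y) \<partial>lborel) = (\<integral>\<^sup>+x. F (A *v x) \<partial>lborel)"
    if [measurable]: "F \<in> borel_measurable borel" for F :: "real ^ 'n \<Rightarrow> ennreal" and y
  proof -
    have "A *v x + y = A *v (x + B *v y)" for x
      by (simp add: matrix_vector_right_distrib matrix_vector_mul_assoc AB)
    then show ?thesis
      using nn_integral_lborel_translate[of "\<lambda>x. F (A *v x)" "B *v y"] by simp
  qed
  have "(\<integral>\<^sup>+x. f (A *v x) \<partial>lborel) = (\<integral>\<^sup>+y. (\<integral>\<^sup>+x. f (A *v x) \<partial>lborel) * indicator ?Q y \<partial>lborel)"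
    by (simp add: nn_integral_cmult emeasure_reference_cube)
  also have "\<dots> = (\<integral>\<^sup>+y. \<integral>\<^sup>+x. f (A *v x + y) * indicator ?Q y \<partial>lborel \<partial>lborel)"
    by (intro nn_integral_cong) (simp add: shift nn_integral_multc)
  also have "\<dots> = (\<integral>\<^sup>+x. \<integral>\<^sup>+y. f (A *v x + y) * indicator ?Q y \<partial>lborel \<partial>lborel)"
    by (intro lborel_pair.Fubini') measurable
  also have "\<dots> = (\<integral>\<^sup>+x. \<integral>\<^sup>+y. f y * indicator ?Q (A *v x + - y) \<partial>lborel \<partial>lborel)"
  proof (rule nn_integral_cong)
    fix x
    have "indicator ?Q (y - A *v x) = (indicator ?Q (A *v x + - y) :: ennreal)" for y
      by (auto simp: reference_cube_def indicator_def abs_minus_commute)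
    then show "(\<integral>\<^sup>+y. f (A *v x + y) * indicator ?Q y \<partial>lborel) = (\<integral>\<^sup>+y. f y * indicator ?Q (A *v x + - y) \<partial>lborel)"
      using nn_integral_lborel_translate[of "\<lambda>y. f y * indicator ?Q (y - A *v x)" "A *v x"]
      by (simp add: add.commute)
  qed
  also have "\<dots> = (\<integral>\<^sup>+y. \<integral>\<^sup>+x. f y * indicator ?Q (A *v x + - y) \<partial>lborel \<partial>lborel)"
    by (intro lborel_pair.Fubini') measurable
  also have "\<dots> = (\<integral>\<^sup>+y. f y * modulus A \<partial>lborel)"
  proof (rule nn_integral_cong)
    fix y
    show "(\<integral>\<^sup>+x. f y * indicator ?Q (A *v x + - y) \<partial>lborel) = f y * modulus A"
      using shift[of "indicator ?Q" "- y"] by (subst nn_integral_cmult) (auto simp: modulus_def)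
  qed
  also have "\<dots> = modulus A * (\<integral>\<^sup>+x. f x \<partial>lborel)"
    by (subst nn_integral_multc) (simp_all add: mult.commute)
  finally show ?thesis .
qed

lemma modulus_mult:
  assumes "invertible A" "invertible B"
  shows "modulus (A ** B) = modulus A * modulus B"
proof -
  have "modulus (A ** B) = (\<integral>\<^sup>+x. indicator reference_cube (A *v (B *v x)) \<partial>lborel)"
    by (simp add: modulus_def matrix_vector_mul_assoc)
  also have "\<dots> = modulus B * (\<integral>\<^sup>+x. indicator reference_cube (A *v x) \<partial>lborel)"
    using assms by (intro nn_integral_matrix_modulus) auto
  finally show ?thesis
    by (simp add: modulus_def mult.commute)
qed

lemma modulus_cube_preserving:
  fixes A :: "real ^ 'n ^ 'n"
  assumes "\<And>x. A *v x \<in> reference_cube \<longleftrightarrow> x \<in> reference_cube"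
  shows "modulus A = 1"
proof -
  have "modulus A = (\<integral>\<^sup>+x. indicator reference_cube (x :: real ^ 'n) \<partial>lborel)"
    unfolding modulus_def using assms by (intro nn_integral_cong) (simp add: indicator_def)
  then show ?thesis
    by (simp add: emeasure_reference_cube)
qed

lemma modulus_diagonal:
  fixes A :: "real ^ 'n ^ 'n"
  assumes diag: "\<And>i j. i \<noteq> j \<Longrightarrow> A $ i $ j = 0" and "det A \<noteq> 0"
  shows "ennreal \<bar>det A\<bar> * modulus A = 1"
proof -
  define c where "c b = (A *v b) \<bullet> b" for b
  define T where "T x = 0 + (\<Sum>b\<in>Basis. (c b * (x \<bullet> b)) *\<^sub>R b)" for x :: "real ^ 'n"
  have det: "det A = (\<Prod>i\<in>UNIV. A $ i $ i)"
    using diag by (simp add: det_diagonal)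
  have Ax: "(A *v x) $ i = A $ i $ i * x $ i" for x i
    by (rule matrix_vector_mult_single_entry) (use diag in auto)
  have c: "c (axis i 1) = A $ i $ i" for i
    by (simp add: c_def inner_axis Ax)
  have T: "T x = A *v x" for x
  proof -
    have "T x = (\<Sum>b\<in>Basis. ((A *v x) \<bullet> b) *\<^sub>R b)"
      unfolding T_def add_0
      by (intro sum.cong refl) (auto simp: Basis_vec_def c inner_axis Ax)
    then show ?thesis by (simp add: euclidean_representation)
  qed
  have inj: "inj (\<lambda>i::'n. axis i (1::real))"
    by (auto simp: inj_def axis_eq_axis)
  have prod: "(\<Prod>b\<in>(Basis::(real ^ 'n) set). \<bar>c b\<bar>) = \<bar>det A\<bar>"
  proof -
    have "(Basis::(real ^ 'n) set) = range (\<lambda>i. axis i 1)"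
      by (auto simp: Basis_vec_def)
    then have "(\<Prod>b\<in>(Basis::(real ^ 'n) set). \<bar>c b\<bar>) = (\<Prod>b\<in>range (\<lambda>i::'n. axis i 1). \<bar>c b\<bar>)"
      by (simp only:)
    also have "\<dots> = \<bar>det A\<bar>"
      by (subst prod.reindex[OF inj]) (simp add: c det abs_prod)
    finally show ?thesis .
  qed
  have [measurable]: "T \<in> borel \<rightarrow>\<^sub>M borel"
    unfolding T_def by measurable
  have "c b \<noteq> 0" if "b \<in> Basis" for b :: "real ^ 'n"
    using that \<open>det A \<noteq> 0\<close> by (auto simp: Basis_vec_def c det)
  then have "lborel = density (distr lborel borel T) (\<lambda>_. ennreal \<bar>det A\<bar>)"
    unfolding T_def prod[symmetric] by (rule lborel_affine_euclidean)
  then have "(\<integral>\<^sup>+x. indicator reference_cube (x :: real ^ 'n) \<partial>lborel)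
      = (\<integral>\<^sup>+x. indicator reference_cube x \<partial>density (distr lborel borel T) (\<lambda>_. ennreal \<bar>det A\<bar>))"
    by simp
  also have "\<dots> = ennreal \<bar>det A\<bar> * (\<integral>\<^sup>+x. indicator reference_cube (T x) \<partial>lborel)"
    by (simp add: nn_integral_density nn_integral_distr nn_integral_cmult del: nn_integral_indicator)
  finally show ?thesis
    by (simp add: emeasure_reference_cube modulus_def T)
qed

text \<open>
  The square of a shear \<open>S\<close> is conjugate to \<open>S\<close> by a diagonal matrix, so \<open>modulus S\<close> is
  idempotent; being invertible, it is \<open>1\<close>.
\<close>

lemma modulus_shear:
  fixes m n :: "'n::finite"
  assumes "m \<noteq> n"
  defines "S \<equiv> ((\<chi> i j. of_bool (i = m \<and> j = n \<or> i = j)) :: real ^ 'n ^ 'n)"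
  shows "modulus S = 1" and "det S = 1"
proof -
  define shear where "shear c = ((\<chi> i j. if i = m \<and> j = n then c else of_bool (i = j)) :: real ^ 'n ^ 'n)" for c
  have S: "S = shear 1"
    by (simp add: S_def shear_def vec_eq_iff)
  have shear: "(shear c *v x) $ i = (if i = m then x $ m + c * x $ n else x $ i)" for c x i
  proof -
    have "(shear c *v x) $ i = (\<Sum>j\<in>UNIV. shear c $ i $ j * x $ j)"
      by (simp add: matrix_vector_mult_def)
    also have "\<dots> = (\<Sum>j\<in>UNIV. (if j = i then x $ i else 0) + (if j = n then (if i = m then c * x $ n else 0) else 0))"
      by (rule sum.cong) (use assms(1) in \<open>auto simp: shear_def\<close>)
    finally show ?thesis
      by (simp add: sum.distrib)
  qed
  define D where "D t = ((\<chi> i j. if i = j then (if i = m then t else 1) else 0) :: real ^ 'n ^ 'n)" for t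
  have D: "(D t *v x) $ i = (if i = m then t * x $ m else x $ i)" for t x i
    by (subst matrix_vector_mult_single_entry[of i]) (auto simp: D_def)
  have id: "shear 1 ** shear (-1) = mat 1" "shear (-1) ** shear 1 = mat 1"
    "D 2 ** D (1/2) = mat 1" "D (1/2) ** D 2 = mat 1"
    and conj: "shear 1 ** shear 1 = (D 2 ** shear 1) ** D (1/2)"
    using assms(1) by (auto simp: matrix_eq matrix_vector_mul_assoc[symmetric] vec_eq_iff shear D)
  have inv: "invertible (shear 1)" "invertible (shear (-1))" "invertible (D 2)" "invertible (D (1/2))"
    using id by (auto simp: invertible_def)
  then have inv': "invertible (D 2 ** shear 1)"
    by (intro invertible_mult)
  have one: "modulus (mat 1 :: real ^ 'n ^ 'n) = 1"
    by (rule modulus_cube_preserving) simp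
  have unit: "modulus (shear 1) * modulus (shear (-1)) = 1" "modulus (D 2) * modulus (D (1/2)) = 1"
    using id inv by (simp_all add: modulus_mult[symmetric] one)
  \<comment> \<open>\<open>S ** S = D ** S ** inverse D\<close>, where \<open>D\<close> doubles coordinate \<open>m\<close>\<close>
  have "modulus (shear 1) * modulus (shear 1) = modulus (D 2) * modulus (shear 1) * modulus (D (1/2))"
    using conj inv inv' by (simp add: modulus_mult[symmetric])
  also have "\<dots> = modulus (shear 1)"
    using unit(2) by (simp add: mult_ac)
  finally have "modulus (shear 1) * modulus (shear 1) * modulus (shear (-1)) = modulus (shear 1) * modulus (shear (-1))"
    by simp
  then show "modulus S = 1"
    using unit(1) by (simp add: S mult.assoc)
  have "S = (\<chi> k. if k = m then row m (mat 1) + 1 *s row n (mat 1) else row k (mat 1 :: real ^ 'n ^ 'n))"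
    using assms(1) by (auto simp: S_def vec_eq_iff row_def mat_def)
  then show "det S = 1"
    using det_row_operation[OF assms(1), of "mat 1 :: real ^ 'n ^ 'n" 1] by simp
qed

lemma modulus_det:
  fixes A :: "real ^ 'n ^ 'n"
  assumes "det A \<noteq> 0"
  shows "ennreal \<bar>det A\<bar> * modulus A = 1"
proof -
  have "det A \<noteq> 0 \<longrightarrow> ennreal \<bar>det A\<bar> * modulus A = 1"
  proof (induction rule: induct_matrix_elementary_alt)
    fix A B :: "real ^ 'n ^ 'n"
    assume IH: "det A \<noteq> 0 \<longrightarrow> ennreal \<bar>det A\<bar> * modulus A = 1" "det B \<noteq> 0 \<longrightarrow> ennreal \<bar>det B\<bar> * modulus B = 1"
    show "det (A ** B) \<noteq> 0 \<longrightarrow> ennreal \<bar>det (A ** B)\<bar> * modulus (A ** B) = 1"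
    proof
      assume "det (A ** B) \<noteq> 0"
      then have nz: "det A \<noteq> 0" "det B \<noteq> 0"
        by (simp_all add: det_mul)
      then have "ennreal \<bar>det (A ** B)\<bar> * modulus (A ** B)
          = (ennreal \<bar>det A\<bar> * modulus A) * (ennreal \<bar>det B\<bar> * modulus B)"
        by (simp add: det_mul abs_mult ennreal_mult modulus_mult invertible_det_nz mult_ac)
      with IH nz show "ennreal \<bar>det (A ** B)\<bar> * modulus (A ** B) = 1"
        by simp
    qed
  next
    fix A :: "real ^ 'n ^ 'n" and i
    assume "row i A = 0"
    then show "det A \<noteq> 0 \<longrightarrow> ennreal \<bar>det A\<bar> * modulus A = 1"
      by (simp add: det_zero_row)
  next
    fix A :: "real ^ 'n ^ 'n"
    assume "\<And>i j. i \<noteq> j \<Longrightarrow> A $ i $ j = 0"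
    then show "det A \<noteq> 0 \<longrightarrow> ennreal \<bar>det A\<bar> * modulus A = 1"
      using modulus_diagonal by blast
  next
    fix m n :: 'n
    assume "m \<noteq> n"
    define p where "p = Transposition.transpose m n"
    define A where "A = ((\<chi> i j. mat 1 $ i $ p j) :: real ^ 'n ^ 'n)"
    have pp: "p (p i) = i" for i
      by (simp add: p_def)
    have Ax: "(A *v x) $ i = x $ p i" for x i
      by (subst matrix_vector_mult_single_entry[of "p i"]) (auto simp: A_def mat_def pp)
    have "modulus A = 1"
    proof (rule modulus_cube_preserving)
      show "A *v x \<in> reference_cube \<longleftrightarrow> x \<in> reference_cube" for x
        unfolding reference_cube_def by (simp add: Ax) (metis pp)
    qed
    moreover have "\<bar>det A\<bar> = 1"
    proof -
      have "p permutes UNIV"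
        by (simp add: p_def permutes_swap_id)
      then have "det A = of_int (sign p) * det (mat 1 :: real ^ 'n ^ 'n)"
        unfolding A_def by (rule det_permute_columns)
      then show ?thesis
        by (simp add: sign_def)
    qed
    ultimately show "det (\<chi> i j. mat 1 $ i $ Transposition.transpose m n j :: real ^ 'n ^ 'n) \<noteq> 0 \<longrightarrow>
        ennreal \<bar>det (\<chi> i j. mat 1 $ i $ Transposition.transpose m n j :: real ^ 'n ^ 'n)\<bar> * modulus (\<chi> i j. mat 1 $ i $ Transposition.transpose m n j :: real ^ 'n ^ 'n) = 1"
      by (simp add: A_def p_def)
  next
    fix m n :: 'n
    assume "m \<noteq> n"
    then show "det (\<chi> i j. of_bool (i = m \<and> j = n \<or> i = j) :: real ^ 'n ^ 'n) \<noteq> 0 \<longrightarrow>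
        ennreal \<bar>det (\<chi> i j. of_bool (i = m \<and> j = n \<or> i = j) :: real ^ 'n ^ 'n)\<bar> * modulus (\<chi> i j. of_bool (i = m \<and> j = n \<or> i = j) :: real ^ 'n ^ 'n) = 1"
      by (simp only: modulus_shear[OF \<open>m \<noteq> n\<close>]) simp
  qed
  with assms show ?thesis by blast
qed

lemma nn_integral_matrix_image:
  fixes A :: "real ^ 'n ^ 'n" and f :: "real ^ 'n \<Rightarrow> ennreal"
  assumes "det A \<noteq> 0" and "f \<in> borel_measurable borel"
  shows "(\<integral>\<^sup>+x. f x \<partial>lborel) = ennreal \<bar>det A\<bar> * (\<integral>\<^sup>+x. f (A *v x) \<partial>lborel)"
  using modulus_det[OF assms(1)] nn_integral_matrix_modulus[of A f] assms
  by (simp add: invertible_det_nz mult.assoc[symmetric])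

section \<open>Averaging over a tiling\<close>

text \<open>
  Folding an integral into the tile \<open>D\<close>: every point lies in exactly one translate \<open>D + l\<close>.
\<close>

lemma nn_integral_tiling:
  fixes D \<Lambda> :: "'a::euclidean_space set" and f :: "'a \<Rightarrow> ennreal"
  assumes "countable \<Lambda>" and [measurable]: "D \<in> sets borel"
    and tiling: "\<And>x. \<exists>!l. l \<in> \<Lambda> \<and> x - l \<in> D"
    and [measurable]: "f \<in> borel_measurable borel"
  shows "(\<integral>\<^sup>+x. f x \<partial>lborel) = (\<integral>\<^sup>+x. (\<integral>\<^sup>+l. f (x + l) \<partial>count_space \<Lambda>) * indicator D x \<partial>lborel)"
proof -
  have "f x = (\<integral>\<^sup>+l. f x * indicator D (x - l) \<partial>count_space \<Lambda>)" for x
  proof -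
    obtain l where l: "l \<in> \<Lambda>" "x - l \<in> D" and uniq: "\<And>k. k \<in> \<Lambda> \<Longrightarrow> x - k \<in> D \<Longrightarrow> k = l"
      using tiling[of x] by auto
    have "(\<integral>\<^sup>+k. f x * indicator D (x - k) \<partial>count_space \<Lambda>) = (\<Sum>k\<in>{l}. f x * indicator D (x - k))"
      using l by (intro nn_integral_count_space') (auto simp: indicator_def dest: uniq)
    with l show ?thesis by simp
  qed
  then have "(\<integral>\<^sup>+x. f x \<partial>lborel) = (\<integral>\<^sup>+x. \<integral>\<^sup>+l. f x * indicator D (x - l) \<partial>count_space \<Lambda> \<partial>lborel)"
    by simp
  also have "\<dots> = (\<integral>\<^sup>+l. \<integral>\<^sup>+x. f x * indicator D (x - l) \<partial>lborel \<partial>count_space \<Lambda>)"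
    using assms(1) by (intro nn_integral_count_space_nn_integral) auto
  also have "\<dots> = (\<integral>\<^sup>+l. \<integral>\<^sup>+x. f (x + l) * indicator D x \<partial>lborel \<partial>count_space \<Lambda>)"
  proof (rule nn_integral_cong)
    fix l
    show "(\<integral>\<^sup>+x. f x * indicator D (x - l) \<partial>lborel) = (\<integral>\<^sup>+x. f (x + l) * indicator D x \<partial>lborel)"
      using nn_integral_lborel_translate[of "\<lambda>x. f x * indicator D (x - l)" l] by simp
  qed
  also have "\<dots> = (\<integral>\<^sup>+x. \<integral>\<^sup>+l. f (x + l) * indicator D x \<partial>count_space \<Lambda> \<partial>lborel)"
    using assms(1) by (intro nn_integral_count_space_nn_integral[symmetric]) auto
  also have "\<dots> = (\<integral>\<^sup>+x. (\<integral>\<^sup>+l. f (x + l) \<partial>count_space \<Lambda>) * indicator D x \<partial>lborel)"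
    by (intro nn_integral_cong nn_integral_multc) auto
  finally show ?thesis .
qed

lemma nn_integral_unit_interval_tiling:
  fixes g :: "real \<Rightarrow> ennreal"
  assumes "g \<in> borel_measurable borel"
  shows "(\<integral>\<^sup>+s. (\<integral>\<^sup>+n. g (s + n) \<partial>count_space \<int>) * indicator {0..<1} s \<partial>lborel) = (\<integral>\<^sup>+s. g s \<partial>lborel)"
proof -
  have "\<exists>!l. l \<in> \<int> \<and> x - l \<in> {0..<1}" for x :: real
  proof (rule ex1I[of _ "of_int \<lfloor>x\<rfloor>"])
    show "of_int \<lfloor>x\<rfloor> \<in> \<int> \<and> x - of_int \<lfloor>x\<rfloor> \<in> {0..<1}"
      by (auto simp: floor_correct) linarith
  next
    fix l assume "l \<in> \<int> \<and> x - l \<in> {0..<1}"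
    then show "l = of_int \<lfloor>x\<rfloor>"
      by (auto elim!: Ints_cases) linarith
  qed
  moreover have "countable (\<int> :: real set)"
    by (simp add: Ints_def)
  ultimately show ?thesis
    using assms by (intro nn_integral_tiling[symmetric]) auto
qed

text \<open>
  The marginal of Lebesgue measure on \<open>K\<close> along \<open>w\<close> has density at most the covolume of \<open>\<Lambda>\<close>. The
  integral is not changed by translating \<open>K\<close> by \<open>s *\<^sub>R a\<close> with \<open>w \<bullet> a = 1\<close>; fold it into \<open>D\<close> and
  average over \<open>s\<close> in the unit interval. For fixed \<open>x\<close> and \<open>s\<close> the packing condition makes
  \<open>l \<mapsto> w \<bullet> l\<close> injective on the \<open>l \<in> \<Lambda>\<close> that contribute, so the sum over \<open>\<Lambda>\<close> is at most
  \<open>\<Sum>\<^sub>n g (w \<bullet> x + s + n)\<close> over all integers \<open>n\<close>, and averaging that over \<open>s\<close> gives the integral of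
  \<open>g\<close>.
\<close>

lemma nn_integral_along_functional_le:
  fixes D \<Lambda> K :: "'a::euclidean_space set" and g :: "real \<Rightarrow> ennreal" and w :: 'a
  assumes \<Lambda>: "countable \<Lambda>" "\<And>k l. k \<in> \<Lambda> \<Longrightarrow> l \<in> \<Lambda> \<Longrightarrow> k - l \<in> \<Lambda>"
    and D[measurable]: "D \<in> sets borel" and tiling: "\<And>x. \<exists>!l. l \<in> \<Lambda> \<and> x - l \<in> D"
    and w: "w \<noteq> 0" "\<And>l. l \<in> \<Lambda> \<Longrightarrow> w \<bullet> l \<in> \<int>"
    and K[measurable]: "K \<in> sets borel"
    and packing: "\<And>x l. x \<in> K \<Longrightarrow> x + l \<in> K \<Longrightarrow> l \<in> \<Lambda> \<Longrightarrow> w \<bullet> l = 0 \<Longrightarrow> l = 0"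
    and g[measurable]: "g \<in> borel_measurable borel"
  shows "(\<integral>\<^sup>+x. g (w \<bullet> x) * indicator K x \<partial>lborel) \<le> emeasure lborel D * (\<integral>\<^sup>+y. g y \<partial>lborel)"
proof -
  define f where "f x = g (w \<bullet> x) * indicator K x" for x
  \<comment> \<open>translation by \<open>s *\<^sub>R a\<close> shifts \<open>w \<bullet> x\<close> by \<open>s\<close>\<close>
  define a where "a = w /\<^sub>R (w \<bullet> w)"
  define G where "G s = (\<integral>\<^sup>+n. g (s + n) \<partial>count_space \<int>)" for s
  have wa: "w \<bullet> a = 1"
    using w by (simp add: a_def)
  have [measurable]: "f \<in> borel_measurable borel"
    unfolding f_def by measurable
  have cint: "countable (\<int> :: real set)"
    by (simp add: Ints_def)
  have "infinite (\<int> :: real set)"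
    unfolding Ints_def using finite_imageD[of real_of_int UNIV] by (auto simp: inj_def infinite_UNIV_int)
  then have "G s = (\<Sum>k. g (s + from_nat_into \<int> k))" for s
    using nn_integral_bij_count_space[OF bij_betw_from_nat_into[OF cint], of "\<lambda>n. g (s + n)"]
    by (simp add: G_def nn_integral_count_space_nat)
  then have [measurable]: "G \<in> borel_measurable borel"
    by (subst measurable_cong) auto
  have layer: "(\<integral>\<^sup>+l. f (x + l + s *\<^sub>R a) \<partial>count_space \<Lambda>) \<le> G (w \<bullet> x + s)" for x s
  proof -
    define N where "N = {l \<in> \<Lambda>. x + l + s *\<^sub>R a \<in> K}"
    have inj: "inj_on ((\<bullet>) w) N"
    proof (rule inj_onI)
      fix k l assume "k \<in> N" "l \<in> N" "w \<bullet> k = w \<bullet> l"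
      then show "k = l"
        using packing[of "x + l + s *\<^sub>R a" "k - l"] \<Lambda>(2)[of k l]
        by (auto simp: N_def inner_diff_right algebra_simps)
    qed
    have "(\<integral>\<^sup>+l. f (x + l + s *\<^sub>R a) \<partial>count_space \<Lambda>) = (\<integral>\<^sup>+l. f (x + l + s *\<^sub>R a) \<partial>count_space N)"
      by (rule nn_integral_count_space_eq) (auto simp: N_def f_def)
    also have "\<dots> = (\<integral>\<^sup>+l. g (w \<bullet> x + s + w \<bullet> l) \<partial>count_space N)"
      by (intro nn_integral_cong) (auto simp: f_def N_def inner_add_right wa algebra_simps)
    also have "\<dots> = (\<integral>\<^sup>+n. g (w \<bullet> x + s + n) \<partial>count_space ((\<bullet>) w ` N))"
      using inj by (intro nn_integral_bij_count_space) (auto simp: bij_betw_def)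
    also have "\<dots> = (\<integral>\<^sup>+n. g (w \<bullet> x + s + n) * indicator ((\<bullet>) w ` N) n \<partial>count_space \<int>)"
      using w(2) by (subst nn_integral_count_space_eq[of "\<int>" "(\<bullet>) w ` N"])
        (auto simp: N_def intro!: nn_integral_cong)
    also have "\<dots> \<le> (\<integral>\<^sup>+n. g (w \<bullet> x + s + n) \<partial>count_space \<int>)"
      by (intro nn_integral_mono) (auto simp: indicator_def)
    finally show ?thesis
      by (simp add: G_def)
  qed
  have "(\<integral>\<^sup>+x. f x \<partial>lborel)
      = (\<integral>\<^sup>+x. (\<integral>\<^sup>+l. f (x + l + s *\<^sub>R a) \<partial>count_space \<Lambda>) * indicator D x \<partial>lborel)" for s
    using nn_integral_tiling[OF \<Lambda>(1) D tiling, of "\<lambda>x. f (x + s *\<^sub>R a)"]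
    by (simp add: nn_integral_lborel_translate)
  also have "\<dots> s \<le> (\<integral>\<^sup>+x. G (w \<bullet> x + s) * indicator D x \<partial>lborel)" for s
    by (intro nn_integral_mono mult_right_mono layer) auto
  finally have "(\<integral>\<^sup>+x. f x \<partial>lborel)
      \<le> (\<integral>\<^sup>+x. G (w \<bullet> x + s) * indicator D x \<partial>lborel)" for s .
  note averaged = this
  have "(\<integral>\<^sup>+s. (\<integral>\<^sup>+x. f x \<partial>lborel) * indicator {0..<1} (s::real) \<partial>lborel)
      \<le> (\<integral>\<^sup>+s. (\<integral>\<^sup>+x. G (w \<bullet> x + s) * indicator D x \<partial>lborel) * indicator {0..<1} s \<partial>lborel)"
    by (rule nn_integral_mono) (rule mult_right_mono[OF averaged], simp)
  also have "(\<integral>\<^sup>+s. (\<integral>\<^sup>+x. f x \<partial>lborel) * indicator {0..<1} (s::real) \<partial>lborel) = (\<integral>\<^sup>+x. f x \<partial>lborel)"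
    by (simp add: nn_integral_cmult)
  also have "(\<integral>\<^sup>+s. (\<integral>\<^sup>+x. G (w \<bullet> x + s) * indicator D x \<partial>lborel) * indicator {0..<1} s \<partial>lborel)
     = (\<integral>\<^sup>+s. \<integral>\<^sup>+x. (G (w \<bullet> x + s) * indicator {0..<1} s) * indicator D x \<partial>lborel \<partial>lborel)"
  proof (rule nn_integral_cong)
    fix s :: real
    have "(\<integral>\<^sup>+x. G (w \<bullet> x + s) * indicator D x \<partial>lborel) * indicator {0..<1} s
      = (\<integral>\<^sup>+x. (G (w \<bullet> x + s) * indicator D x) * indicator {0..<1} s \<partial>lborel)"
      by (intro nn_integral_multc[symmetric]) measurable
    then show "(\<integral>\<^sup>+x. G (w \<bullet> x + s) * indicator D x \<partial>lborel) * indicator {0..<1} s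
      = (\<integral>\<^sup>+x. (G (w \<bullet> x + s) * indicator {0..<1} s) * indicator D x \<partial>lborel)"
      by (simp only: mult.assoc mult.commute mult.left_commute)
  qed
  also have "\<dots> = (\<integral>\<^sup>+x. \<integral>\<^sup>+s. (G (w \<bullet> x + s) * indicator {0..<1} s) * indicator D x \<partial>lborel \<partial>lborel)"
    by (intro lborel_pair.Fubini') measurable
  also have "\<dots> = (\<integral>\<^sup>+x. (\<integral>\<^sup>+y. g y \<partial>lborel) * indicator D x \<partial>lborel)"
  proof (rule nn_integral_cong)
    fix x
    have "(\<integral>\<^sup>+s. (G (w \<bullet> x + s) * indicator {0..<1} s) * indicator D x \<partial>lborel)
      = (\<integral>\<^sup>+s. G (w \<bullet> x + s) * indicator {0..<1} s \<partial>lborel) * indicator D x"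
      by (intro nn_integral_multc) measurable
    also have "(\<integral>\<^sup>+s. G (w \<bullet> x + s) * indicator {0..<1} s \<partial>lborel) = (\<integral>\<^sup>+s. g (w \<bullet> x + s) \<partial>lborel)"
      using nn_integral_unit_interval_tiling[of "\<lambda>s. g (w \<bullet> x + s)"] by (simp add: G_def add.assoc)
    also have "\<dots> = (\<integral>\<^sup>+s. g s \<partial>lborel)"
      using nn_integral_lborel_translate[of g "w \<bullet> x"] by (simp add: add.commute)
    finally show "(\<integral>\<^sup>+s. (G (w \<bullet> x + s) * indicator {0..<1} s) * indicator D x \<partial>lborel) = (\<integral>\<^sup>+y. g y \<partial>lborel) * indicator D x" .
  qed
  also have "\<dots> = emeasure lborel D * (\<integral>\<^sup>+y. g y \<partial>lborel)"
    by (subst nn_integral_cmult_indicator) (simp_all add: mult.commute)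
  finally show ?thesis
    by (simp add: f_def)
qed

section \<open>The second moment of the cube\<close>

text \<open>
  Distinct coordinates are uncorrelated because the reflection in one of them preserves the cube
  and changes the sign of the product.
\<close>

lemma integral_cube_coordinate_product:
  fixes b c :: "'a::euclidean_space"
  assumes "0 < q" "b \<in> Basis" "c \<in> Basis"
  shows "(LINT x|lborel. indicator (cbox (- (q *\<^sub>R One)) (q *\<^sub>R One)) x * ((x \<bullet> b) * (x \<bullet> c))) =
    (if b = c then (2 * q) ^ DIM('a) * q\<^sup>2 / 3 else 0)" (is "?I = _")
proof -
  define Q where "Q = (cbox (- (q *\<^sub>R One)) (q *\<^sub>R One) :: 'a set)"
  have Q: "x \<in> Q \<longleftrightarrow> (\<forall>e\<in>Basis. \<bar>x \<bullet> e\<bar> \<le> q)" for x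
    by (auto simp: Q_def mem_box abs_le_iff minus_le_iff)
  have [measurable]: "Q \<in> sets borel"
    by (simp add: Q_def)
  show ?thesis
  proof (cases "b = c")
    case False
    define f where "f x = indicator Q x * ((x \<bullet> b) * (x \<bullet> c))" for x
    define s where "s e = (if e = b then -1 else 1 :: real)" for e
    define T where "T x = 0 + (\<Sum>e\<in>Basis. (s e * (x \<bullet> e)) *\<^sub>R e)" for x :: 'a
    have [measurable]: "f \<in> borel_measurable borel" "T \<in> borel \<rightarrow>\<^sub>M borel"
      unfolding f_def T_def by measurable
    have T: "T x \<bullet> e = s e * (x \<bullet> e)" if "e \<in> Basis" for x e
      using that by (simp add: T_def inner_sum_left inner_Basis sum.delta if_distrib cong: if_cong)
    have "lborel = density (distr lborel borel T) (\<lambda>_. ennreal (\<Prod>j\<in>(Basis::'a set). \<bar>s j\<bar>))"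
      unfolding T_def by (rule lborel_affine_euclidean) (simp add: s_def)
    also have "(\<Prod>j\<in>(Basis::'a set). \<bar>s j\<bar>) = 1"
      by (rule prod.neutral) (simp add: s_def)
    finally have "lborel = distr lborel borel T"
      by (simp add: density_1)
    then have "integral\<^sup>L lborel f = integral\<^sup>L (distr lborel borel T) f"
      by simp
    also have "\<dots> = (LINT x|lborel. f (T x))"
      by (rule integral_distr) auto
    also have "(\<lambda>x. f (T x)) = (\<lambda>x. - f x)"
    proof
      fix x
      have "T x \<in> Q \<longleftrightarrow> x \<in> Q"
        unfolding Q by (intro ball_cong) (auto simp: T s_def)
      then show "f (T x) = - f x"
        using False assms by (simp add: f_def T s_def indicator_def)
    qed
    finally have "integral\<^sup>L lborel f = 0"
      by simp
    then show ?thesis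
      using False by (simp add: f_def[abs_def] Q_def)
  next
    case True
    define h where "h e y = indicator {-q..q} y * (if e = b then y\<^sup>2 else 1)" for e and y :: real
    have h0: "0 \<le> h e y" for e y
      by (simp add: h_def)
    have prod_h: "(\<Prod>e\<in>Basis. h e (x \<bullet> e)) = indicator Q x * ((x \<bullet> b) * (x \<bullet> c))" for x
    proof -
      have "(\<Prod>e\<in>Basis. h e (x \<bullet> e)) = (\<Prod>e\<in>Basis. indicator {-q..q} (x \<bullet> e)) * (x \<bullet> b)\<^sup>2"
        using assms by (simp add: h_def prod.distrib)
      also have "(\<Prod>e\<in>Basis. indicator {-q..q} (x \<bullet> e)) = (indicator Q x :: real)"
        by (auto simp: Q indicator_def abs_le_iff minus_le_iff intro!: prod.neutral prod_zero)
      finally show ?thesis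
        using True by (simp add: power2_eq_square)
    qed
    have "(\<integral>\<^sup>+y. h e y \<partial>lborel) = ennreal ((2 * q) * (if e = b then q\<^sup>2 / 3 else 1))" for e
    proof (cases "e = b")
      case True
      have "(\<integral>\<^sup>+y. h e y \<partial>lborel) = (\<integral>\<^sup>+y. ennreal (y\<^sup>2) * indicator {-q..q} y \<partial>lborel)"
        using True by (intro nn_integral_cong) (auto simp: h_def indicator_def)
      also have "\<dots> = ennreal (q ^ 3 / 3 - (- q) ^ 3 / 3)"
        using assms by (intro nn_integral_FTC_Icc) (auto intro!: derivative_eq_intros)
      finally show ?thesis
        using True by (simp add: power3_eq_cube power2_eq_square mult.assoc)
    next
      case False
      have "(\<integral>\<^sup>+y. h e y \<partial>lborel) = (\<integral>\<^sup>+y. indicator {-q..q} y \<partial>lborel)"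
        using False by (intro nn_integral_cong) (auto simp: h_def indicator_def)
      then show ?thesis
        using False assms by simp
    qed
    then have "(\<Prod>e\<in>Basis. \<integral>\<^sup>+y. ennreal (h e y) \<partial>lborel) = ennreal (\<Prod>e\<in>Basis. (2 * q) * (if e = b then q\<^sup>2 / 3 else 1))"
      using assms by (simp add: prod_ennreal)
    also have "(\<Prod>e\<in>(Basis::'a set). (2 * q) * (if e = b then q\<^sup>2 / 3 else 1)) = (2 * q) ^ DIM('a) * q\<^sup>2 / 3"
      using assms by (simp add: prod.distrib)
    also have "(\<Prod>e\<in>Basis. \<integral>\<^sup>+y. ennreal (h e y) \<partial>lborel) = (\<integral>\<^sup>+x. (\<Prod>e\<in>(Basis::'a set). ennreal (h e (x \<bullet> e))) \<partial>lborel)"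
      by (rule nn_integral_lborel_prod[symmetric]) (auto simp: h_def)
    finally have "(\<integral>\<^sup>+x. ennreal (\<Prod>e\<in>Basis. h e ((x::'a) \<bullet> e)) \<partial>lborel) = ennreal ((2 * q) ^ DIM('a) * q\<^sup>2 / 3)"
      using h0 by (simp add: prod_ennreal)
    then have "(\<integral>\<^sup>+x. ennreal (indicator Q x * ((x \<bullet> b) * (x \<bullet> c))) \<partial>lborel) = ennreal ((2 * q) ^ DIM('a) * q\<^sup>2 / 3)"
      by (simp add: prod_h)
    then have "?I = (2 * q) ^ DIM('a) * q\<^sup>2 / 3"
      unfolding Q_def[symmetric] using True assms
      by (subst integral_eq_nn_integral) auto
    with True show ?thesis by simp
  qed
qed

lemma nn_integral_cube_inner_square:
  fixes w :: "'a::euclidean_space"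
  assumes "0 < q"
  shows "(\<integral>\<^sup>+x. ennreal ((w \<bullet> x)\<^sup>2) * indicator (cbox (- (q *\<^sub>R One)) (q *\<^sub>R One)) x \<partial>lborel) =
    ennreal ((2 * q) ^ DIM('a) * q\<^sup>2 / 3 * (w \<bullet> w))"
proof -
  define Q where "Q = (cbox (- (q *\<^sub>R One)) (q *\<^sub>R One) :: 'a set)"
  have integrable: "integrable lborel (\<lambda>x. indicator Q x * F x)" if "continuous_on Q F" for F :: "'a \<Rightarrow> real"
    using borel_integrable_compact[OF _ that] by (simp add: Q_def)
  have expand: "indicator Q x * (w \<bullet> x)\<^sup>2 =
     (\<Sum>b\<in>Basis. \<Sum>c\<in>Basis. (w \<bullet> b) * (w \<bullet> c) * (indicator Q x * ((x \<bullet> b) * (x \<bullet> c))))" for x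
    by (subst euclidean_inner) (simp add: power2_eq_square sum_product sum_distrib_left ac_simps)
  have int: "integrable lborel (\<lambda>x. indicator Q x * ((x \<bullet> b) * (x \<bullet> c)))" for b c
    by (intro integrable continuous_intros)
  have "(LINT x|lborel. indicator Q x * (w \<bullet> x)\<^sup>2) =
     (\<Sum>b\<in>Basis. \<Sum>c\<in>Basis. (w \<bullet> b) * (w \<bullet> c) * (LINT x|lborel. indicator Q x * ((x \<bullet> b) * (x \<bullet> c))))"
    unfolding expand using int by (simp add: Bochner_Integration.integral_sum)
  also have "\<dots> = (\<Sum>b\<in>Basis. \<Sum>c\<in>Basis. (w \<bullet> b) * (w \<bullet> c) * (if b = c then (2 * q) ^ DIM('a) * q\<^sup>2 / 3 else 0))"
    unfolding Q_def using assms by (intro sum.cong refl) (simp add: integral_cube_coordinate_product)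
  also have "\<dots> = (\<Sum>b\<in>Basis. (w \<bullet> b) * (w \<bullet> b) * ((2 * q) ^ DIM('a) * q\<^sup>2 / 3))"
    by (intro sum.cong refl) (simp add: if_distrib sum.delta cong: if_cong)
  also have "\<dots> = (2 * q) ^ DIM('a) * q\<^sup>2 / 3 * (w \<bullet> w)"
    by (subst (3) euclidean_inner) (simp add: sum_distrib_left ac_simps)
  finally have I: "(LINT x|lborel. indicator Q x * (w \<bullet> x)\<^sup>2) = (2 * q) ^ DIM('a) * q\<^sup>2 / 3 * (w \<bullet> w)" .
  have "(\<integral>\<^sup>+x. ennreal ((w \<bullet> x)\<^sup>2) * indicator Q x \<partial>lborel) = (\<integral>\<^sup>+x. ennreal (indicator Q x * (w \<bullet> x)\<^sup>2) \<partial>lborel)"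
    by (intro nn_integral_cong) (auto simp: indicator_def)
  also have "\<dots> = ennreal (LINT x|lborel. indicator Q x * (w \<bullet> x)\<^sup>2)"
    by (intro nn_integral_eq_integral integrable continuous_intros) auto
  finally show ?thesis
    unfolding I unfolding Q_def .
qed

section \<open>Cubes packed along a hyperplane\<close>

text \<open>
  Compare the second moment of the cube along \<open>w\<close> with the least second moment that a density
  bounded by \<open>M\<close> can have. The latter is attained by the constant density \<open>M\<close> on \<open>[-r, r]\<close> with
  \<open>r = V / (2 M)\<close>, and the comparison is made by integrating
  \<open>r\<^sup>2 \<le> (w \<bullet> x)\<^sup>2 + max 0 (r\<^sup>2 - (w \<bullet> x)\<^sup>2)\<close> over the cube.
\<close>

lemma packed_cube_functional_bound:
  fixes D \<Lambda> :: "'a::euclidean_space set" and w :: 'a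
  assumes \<Lambda>: "countable \<Lambda>" "\<And>k l. k \<in> \<Lambda> \<Longrightarrow> l \<in> \<Lambda> \<Longrightarrow> k - l \<in> \<Lambda>"
    and D: "D \<in> sets borel" "\<And>x. \<exists>!l. l \<in> \<Lambda> \<and> x - l \<in> D" "emeasure lborel D = ennreal M" "0 < M"
    and w: "w \<noteq> 0" "\<And>l. l \<in> \<Lambda> \<Longrightarrow> w \<bullet> l \<in> \<int>"
    and "0 < q"
    and packing: "\<And>x l. x \<in> cbox (- (q *\<^sub>R One)) (q *\<^sub>R One) \<Longrightarrow> x + l \<in> cbox (- (q *\<^sub>R One)) (q *\<^sub>R One) \<Longrightarrow>
      l \<in> \<Lambda> \<Longrightarrow> w \<bullet> l = 0 \<Longrightarrow> l = 0"
  shows "((2 * q) ^ DIM('a))\<^sup>2 \<le> M\<^sup>2 * (w \<bullet> w) * (2 * q)\<^sup>2"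
proof -
  define Q where "Q = (cbox (- (q *\<^sub>R One)) (q *\<^sub>R One) :: 'a set)"
  define V where "V = (2 * q) ^ DIM('a)"
  define r where "r = V / (2 * M)"
  define g where "g y = ennreal (r\<^sup>2 - y\<^sup>2) * indicator {-r..r} y" for y
  have pos: "0 < V" "0 < r"
    using \<open>0 < q\<close> \<open>0 < M\<close> by (simp_all add: V_def r_def)
  have [measurable]: "Q \<in> sets borel" "g \<in> borel_measurable borel"
    unfolding Q_def g_def by measurable
  have "emeasure lborel Q = ennreal (\<Prod>b\<in>(Basis::'a set). (q *\<^sub>R One - - (q *\<^sub>R One)) \<bullet> b)"
    unfolding Q_def using \<open>0 < q\<close> by (intro emeasure_lborel_cbox) simp
  also have "(\<Prod>b\<in>(Basis::'a set). (q *\<^sub>R One - - (q *\<^sub>R One)) \<bullet> b) = (\<Prod>b\<in>(Basis::'a set). 2 * q)"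
    by (intro prod.cong refl) (simp add: inner_add_left)
  finally have V: "emeasure lborel Q = ennreal V"
    by (simp add: V_def)
  have "(\<integral>\<^sup>+y. g y \<partial>lborel) = ennreal ((r\<^sup>2 * r - r ^ 3 / 3) - (r\<^sup>2 * (-r) - (- r) ^ 3 / 3))"
    unfolding g_def using pos
    by (intro nn_integral_FTC_Icc[where F = "\<lambda>y. r\<^sup>2 * y - y ^ 3 / 3"])
      (auto intro!: derivative_eq_intros simp: abs_le_square_iff[symmetric])
  then have g: "(\<integral>\<^sup>+y. g y \<partial>lborel) = ennreal (4 / 3 * r ^ 3)"
    by (simp add: power3_eq_cube power2_eq_square mult.assoc)
  have "ennreal (r\<^sup>2) * indicator Q x \<le> ennreal ((w \<bullet> x)\<^sup>2) * indicator Q x + g (w \<bullet> x) * indicator Q x" for x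
  proof (cases "\<bar>w \<bullet> x\<bar> \<le> r")
    case True
    then have "(w \<bullet> x)\<^sup>2 \<le> r\<^sup>2"
      by (simp add: abs_le_square_iff[symmetric])
    then show ?thesis
      using True by (auto simp: g_def indicator_def abs_le_iff ennreal_plus[symmetric] simp del: ennreal_plus)
  next
    case False
    then have "r\<^sup>2 \<le> (w \<bullet> x)\<^sup>2"
      using pos by (simp add: abs_le_square_iff[symmetric])
    then show ?thesis
      by (auto simp: indicator_def intro: add_increasing2 ennreal_leI)
  qed
  then have "(\<integral>\<^sup>+x. ennreal (r\<^sup>2) * indicator Q x \<partial>lborel)
      \<le> (\<integral>\<^sup>+x. ennreal ((w \<bullet> x)\<^sup>2) * indicator Q x + g (w \<bullet> x) * indicator Q x \<partial>lborel)"
    by (intro nn_integral_mono)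
  also have "\<dots> = (\<integral>\<^sup>+x. ennreal ((w \<bullet> x)\<^sup>2) * indicator Q x \<partial>lborel) + (\<integral>\<^sup>+x. g (w \<bullet> x) * indicator Q x \<partial>lborel)"
    by (intro nn_integral_add) measurable
  also have "\<dots> \<le> ennreal (V * q\<^sup>2 / 3 * (w \<bullet> w)) + ennreal M * ennreal (4 / 3 * r ^ 3)"
  proof (rule add_mono)
    show "(\<integral>\<^sup>+x. ennreal ((w \<bullet> x)\<^sup>2) * indicator Q x \<partial>lborel) \<le> ennreal (V * q\<^sup>2 / 3 * (w \<bullet> w))"
      unfolding Q_def V_def using nn_integral_cube_inner_square[OF \<open>0 < q\<close>, of w] by simp
    have "(\<integral>\<^sup>+x. g (w \<bullet> x) * indicator Q x \<partial>lborel) \<le> emeasure lborel D * (\<integral>\<^sup>+y. g y \<partial>lborel)"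
      using packing unfolding Q_def[symmetric]
      by (intro nn_integral_along_functional_le[OF \<Lambda> D(1,2) w]) auto
    then show "(\<integral>\<^sup>+x. g (w \<bullet> x) * indicator Q x \<partial>lborel) \<le> ennreal M * ennreal (4 / 3 * r ^ 3)"
      by (simp only: g D(3))
  qed
  also have "\<dots> = ennreal (V * q\<^sup>2 / 3 * (w \<bullet> w) + M * (4 / 3 * r ^ 3))"
    using pos \<open>0 < M\<close> by (simp add: ennreal_mult[symmetric] ennreal_plus[symmetric] del: ennreal_plus)
  finally have "ennreal (r\<^sup>2) * ennreal V \<le> ennreal (V * q\<^sup>2 / 3 * (w \<bullet> w) + M * (4 / 3 * r ^ 3))"
    by (simp add: nn_integral_cmult V del: ennreal_plus)
  then have "r\<^sup>2 * V \<le> V * q\<^sup>2 / 3 * (w \<bullet> w) + M * (4 / 3 * r ^ 3)"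
    using pos \<open>0 < M\<close> by (simp add: ennreal_mult[symmetric] ennreal_le_iff del: ennreal_plus)
  also have "M * (4 / 3 * r ^ 3) = 2 / 3 * r\<^sup>2 * V"
    using \<open>0 < M\<close> by (simp add: r_def power3_eq_cube power2_eq_square)
  finally have "V * r\<^sup>2 \<le> V * (q\<^sup>2 * (w \<bullet> w))"
    by (simp add: algebra_simps)
  then have "r\<^sup>2 \<le> q\<^sup>2 * (w \<bullet> w)"
    using pos by simp
  then have "(2 * M)\<^sup>2 * r\<^sup>2 \<le> (2 * M)\<^sup>2 * (q\<^sup>2 * (w \<bullet> w))"
    by (rule mult_left_mono) simp
  also have "(2 * M)\<^sup>2 * r\<^sup>2 = V\<^sup>2"
    using \<open>0 < M\<close> by (simp add: r_def power2_eq_square)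
  finally show ?thesis
    by (simp add: V_def power_mult_distrib mult_ac)
qed

section \<open>Integer points and the first successive minimum\<close>

lemma integer_lattice_eq_image:
  "integer_lattice = vec_lambda ` (PiE UNIV (\<lambda>_. \<int>))"
proof (intro set_eqI iffI)
  fix x :: "real ^ 'n" assume "x \<in> integer_lattice"
  then have "x = vec_lambda (\<lambda>i. x $ i)" "(\<lambda>i. x $ i) \<in> PiE UNIV (\<lambda>_. \<int>)"
    by (auto simp: integer_lattice_def)
  then show "x \<in> vec_lambda ` (PiE UNIV (\<lambda>_. \<int>))"
    by blast
qed (auto simp: integer_lattice_def)

lemma countable_integer_lattice: "countable integer_lattice"
  unfolding integer_lattice_eq_image by (intro countable_image countable_PiE) (auto simp: Ints_def)

lemma integer_lattice_diff: "x \<in> integer_lattice \<Longrightarrow> y \<in> integer_lattice \<Longrightarrow> x - y \<in> integer_lattice"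
  by (auto simp: integer_lattice_def)

lemma inner_integer_lattice: "x \<in> integer_lattice \<Longrightarrow> y \<in> integer_lattice \<Longrightarrow> x \<bullet> y \<in> \<int>"
  by (auto simp: integer_lattice_def inner_vec_def intro!: Ints_sum Ints_mult)

lemma all_Basis_vec: "(\<forall>b\<in>(Basis :: (real ^ 'n) set). R (x \<bullet> b)) \<longleftrightarrow> (\<forall>i. R (x $ i))"
  by (auto simp: Basis_vec_def inner_axis)

lemma infnorm_le_iff: "infnorm (x :: real ^ 'n) \<le> r \<longleftrightarrow> (\<forall>i. \<bar>x $ i\<bar> \<le> r)"
  using all_Basis_vec[of "\<lambda>t. \<bar>t\<bar> \<le> r" x] by (simp add: infnorm_Max)

lemma unit_cube_infnorm: "x \<in> unit_cube \<longleftrightarrow> infnorm x \<le> 1"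
  by (simp add: unit_cube_def infnorm_le_iff)

lemma finite_integer_lattice_bounded:
  fixes F :: "real ^ 'n ^ 'n"
  assumes "invertible F"
  shows "finite {z \<in> integer_lattice. infnorm (F *v z) \<le> R}"
proof -
  obtain G where G: "G ** F = mat 1"
    using assms by (auto simp: invertible_def)
  obtain B where B: "\<And>y. norm (G *v y) \<le> B * norm y" "0 < B"
    using linear_bounded_pos[of "(*v) G"] by auto
  define C where "C = B * (sqrt (DIM(real ^ 'n)) * R)"
  have "\<bar>z $ i\<bar> \<le> C" if "infnorm (F *v z) \<le> R" for z i
  proof -
    have "\<bar>z $ i\<bar> \<le> norm z"
      by (rule component_le_norm_cart)
    also have "norm z = norm (G *v (F *v z))"
      by (simp add: matrix_vector_mul_assoc G)
    also have "norm (G *v (F *v z)) \<le> B * norm (F *v z)"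
      by (rule B)
    also have "\<dots> \<le> B * (sqrt (DIM(real ^ 'n)) * infnorm (F *v z))"
      using B norm_le_infnorm[of "F *v z"] by (intro mult_left_mono) auto
    also have "\<dots> \<le> C"
      unfolding C_def using B that by (intro mult_left_mono) auto
    finally show ?thesis .
  qed
  then have "{z \<in> integer_lattice. infnorm (F *v z) \<le> R} \<subseteq> vec_lambda ` (PiE UNIV (\<lambda>_::'n. {k \<in> \<int>. \<bar>k\<bar> \<le> C}))"
    by (auto simp: integer_lattice_def intro!: image_eqI[of _ vec_lambda "vec_nth _"])
  moreover have "finite (vec_lambda ` (PiE UNIV (\<lambda>_::'n. {k \<in> \<int>. \<bar>k\<bar> \<le> C})))"
    by (intro finite_imageI finite_PiE) (auto simp: finite_abs_int_segment)
  ultimately show ?thesis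
    by (rule finite_subset)
qed

text \<open>
  The set over which the successive minimum is taken has a least element, because only finitely
  many integer points lie in a bounded region; without this \<open>Least\<close> would carry no information.
\<close>

lemma successive_minimum_1_le_1_iff:
  fixes F :: "real ^ 'n ^ 'n"
  assumes "invertible F"
  shows "successive_minimum 1 {z. F *v z \<in> unit_cube} integer_lattice \<le> 1 \<longleftrightarrow>
    (\<exists>z\<in>integer_lattice. z \<noteq> 0 \<and> F *v z \<in> unit_cube)"
proof -
  define N where "N z = infnorm (F *v z)" for z
  define Z where "Z = integer_lattice - {0 :: real ^ 'n}"
  have N_pos: "0 < N z" if "z \<noteq> 0" for z
    using assms that matrix_left_invertible_ker[of F] by (auto simp: N_def infnorm_pos_lt invertible_def)
  have admissible: "0 < m \<and> (\<exists>S. S \<subseteq> (*\<^sub>R) m ` {z. F *v z \<in> unit_cube} \<inter> integer_lattice \<and> card S = 1 \<and> independent S)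
      \<longleftrightarrow> 0 < m \<and> (\<exists>z\<in>Z. N z \<le> m)" for m
  proof (intro conj_cong refl)
    assume m: "0 < m"
    have scaled: "z \<in> (*\<^sub>R) m ` {z. F *v z \<in> unit_cube} \<longleftrightarrow> N z \<le> m" for z
    proof
      assume "z \<in> (*\<^sub>R) m ` {z. F *v z \<in> unit_cube}"
      then show "N z \<le> m"
        using m by (auto simp: N_def unit_cube_infnorm matrix_vector_mult_scaleR infnorm_mul)
    next
      assume "N z \<le> m"
      then have "F *v ((1 / m) *\<^sub>R z) \<in> unit_cube"
        using m by (simp add: N_def unit_cube_infnorm matrix_vector_mult_scaleR infnorm_mul)
      moreover have "z = m *\<^sub>R ((1 / m) *\<^sub>R z)"
        using m by simp
      ultimately show "z \<in> (*\<^sub>R) m ` {z. F *v z \<in> unit_cube}"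
        by blast
    qed
    show "(\<exists>S. S \<subseteq> (*\<^sub>R) m ` {z. F *v z \<in> unit_cube} \<inter> integer_lattice \<and> card S = 1 \<and> independent S)
      \<longleftrightarrow> (\<exists>z\<in>Z. N z \<le> m)" (is "?A \<longleftrightarrow> ?B")
    proof
      assume ?A
      then obtain z where "{z} \<subseteq> (*\<^sub>R) m ` {z. F *v z \<in> unit_cube} \<inter> integer_lattice" "independent {z}"
        by (auto simp: card_1_singleton_iff)
      then show ?B
        using dependent_zero[of "{z}"] by (auto simp: scaled Z_def)
    next
      assume ?B
      then obtain z where "z \<in> Z" "N z \<le> m" by blast
      then show ?A
        by (intro exI[of _ "{z}"]) (auto simp: scaled Z_def)
    qed
  qed
  define u :: "real ^ 'n" where "u = (\<chi> i. 1)"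
  define Y where "Y = {z \<in> Z. N z \<le> N u}"
  have "Y \<subseteq> {z \<in> integer_lattice. infnorm (F *v z) \<le> N u}"
    by (auto simp: Y_def Z_def N_def)
  then have "finite Y"
    by (rule finite_subset[OF _ finite_integer_lattice_bounded[OF assms]])
  moreover have "u \<in> Y"
    by (auto simp: Y_def Z_def u_def integer_lattice_def vec_eq_iff)
  ultimately obtain y where y: "y \<in> Y" "\<And>z. z \<in> Y \<Longrightarrow> N y \<le> N z"
    using ex_min_if_finite[of "N ` Y"] by (auto simp: not_less)
  have y_min: "N y \<le> N z" if "z \<in> Z" for z
    using y(1) y(2)[of z] that by (cases "N z \<le> N u") (auto simp: Y_def)
  have "successive_minimum 1 {z. F *v z \<in> unit_cube} integer_lattice = N y"
    unfolding successive_minimum_def admissible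
  proof (rule Least_equality)
    show "0 < N y \<and> (\<exists>z\<in>Z. N z \<le> N y)"
      using y(1) N_pos by (auto simp: Y_def Z_def)
  next
    fix m assume "0 < m \<and> (\<exists>z\<in>Z. N z \<le> m)"
    then show "N y \<le> m"
      using y_min by force
  qed
  moreover have "N y \<le> 1 \<longleftrightarrow> (\<exists>z\<in>Z. N z \<le> 1)"
    using y(1) y_min by (force simp: Y_def)
  ultimately show ?thesis
    by (auto simp: Z_def N_def unit_cube_infnorm)
qed

section \<open>Lattice points in central sections of the cube\<close>

lemma unit_cell_tiling:
  "\<exists>!l. l \<in> integer_lattice \<and> x - l \<in> {u :: real ^ 'n. \<forall>i. 0 \<le> u $ i \<and> u $ i < 1}"
proof (rule ex1I[of _ "\<chi> i. of_int \<lfloor>x $ i\<rfloor>"])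
  show "(\<chi> i. of_int \<lfloor>x $ i\<rfloor>) \<in> integer_lattice \<and> x - (\<chi> i. of_int \<lfloor>x $ i\<rfloor>) \<in> {u. \<forall>i. 0 \<le> u $ i \<and> u $ i < 1}"
    by (auto simp: integer_lattice_def floor_correct) linarith
next
  fix l assume l: "l \<in> integer_lattice \<and> x - l \<in> {u. \<forall>i. 0 \<le> u $ i \<and> u $ i < 1}"
  have "l $ i = of_int \<lfloor>x $ i\<rfloor>" for i
  proof -
    have "l $ i \<in> \<int>" "0 \<le> x $ i - l $ i" "x $ i - l $ i < 1"
      using l by (auto simp: integer_lattice_def)
    then show ?thesis
      by (auto elim!: Ints_cases) linarith
  qed
  then show "l = (\<chi> i. of_int \<lfloor>x $ i\<rfloor>)"
    by (simp add: vec_eq_iff)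
qed

lemma emeasure_unit_cell:
  "{u :: real ^ 'n. \<forall>i. 0 \<le> u $ i \<and> u $ i < 1} \<in> sets borel"
  "emeasure lborel {u :: real ^ 'n. \<forall>i. 0 \<le> u $ i \<and> u $ i < 1} = 1"
proof -
  define C where "C = {u :: real ^ 'n. \<forall>i. 0 \<le> u $ i \<and> u $ i < 1}"
  have C: "C = {u. \<forall>b\<in>Basis. 0 \<le> u \<bullet> b \<and> u \<bullet> b < 1}"
    using all_Basis_vec[of "\<lambda>t. 0 \<le> t \<and> t < 1"] by (auto simp: C_def)
  show meas: "{u :: real ^ 'n. \<forall>i. 0 \<le> u $ i \<and> u $ i < 1} \<in> sets borel"
    unfolding C_def[symmetric] C by measurable
  have "emeasure lborel C = (\<integral>\<^sup>+x. indicator C x \<partial>lborel)"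
    using meas by (simp add: C_def)
  also have "\<dots> = (\<integral>\<^sup>+x. (\<Prod>b\<in>Basis. indicator {0..<1} ((x :: real ^ 'n) \<bullet> b)) \<partial>lborel)"
  proof (intro nn_integral_cong)
    fix x :: "real ^ 'n"
    show "indicator C x = (\<Prod>b\<in>Basis. indicator {0..<1} (x \<bullet> b) :: ennreal)"
      by (auto simp: C indicator_def intro!: prod.neutral[symmetric] prod_zero[symmetric] dest!: bspec)
  qed
  also have "\<dots> = 1"
    by (subst nn_integral_lborel_prod) (auto simp: ennreal_indicator)
  finally show "emeasure lborel {u :: real ^ 'n. \<forall>i. 0 \<le> u $ i \<and> u $ i < 1} = 1"
    by (simp add: C_def)
qed

lemma emeasure_linear_image_unit_cell:
  fixes L G :: "real ^ 'n ^ 'n"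
  assumes LG: "L ** G = mat 1" and GL: "G ** L = mat 1"
  shows "(*v) L ` {u. \<forall>i. 0 \<le> u $ i \<and> u $ i < 1} \<in> sets borel"
    and "emeasure lborel ((*v) L ` {u. \<forall>i. 0 \<le> u $ i \<and> u $ i < 1}) = ennreal \<bar>det L\<bar>"
proof -
  define C where "C = {u :: real ^ 'n. \<forall>i. 0 \<le> u $ i \<and> u $ i < 1}"
  have C[measurable]: "C \<in> sets borel" and C1: "emeasure lborel C = 1"
    unfolding C_def by (rule emeasure_unit_cell)+
  have L_inj: "inj ((*v) L)"
    by (rule inj_on_inverseI[of _ "(*v) G"]) (simp add: matrix_vector_mul_assoc GL)
  have det: "det L \<noteq> 0"
    using LG GL by (auto simp: invertible_det_nz[symmetric] invertible_def)
  have "(*v) L ` C = (*v) G -` C \<inter> space borel"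
  proof (intro set_eqI iffI)
    fix x assume "x \<in> (*v) G -` C \<inter> space borel"
    moreover have "x = L *v (G *v x)"
      by (simp add: matrix_vector_mul_assoc LG)
    ultimately show "x \<in> (*v) L ` C" by blast
  qed (auto simp: matrix_vector_mul_assoc GL)
  moreover have "(*v) G \<in> borel \<rightarrow>\<^sub>M borel"
    by (intro borel_measurable_continuous_onI matrix_vector_mult_linear_continuous_on)
  ultimately show meas: "(*v) L ` {u. \<forall>i. 0 \<le> u $ i \<and> u $ i < 1} \<in> sets borel"
    unfolding C_def[symmetric] using measurable_sets[of "(*v) G" borel borel C] C by simp
  have "emeasure lborel ((*v) L ` C) = (\<integral>\<^sup>+x. indicator ((*v) L ` C) x \<partial>lborel)"
    using meas by (simp add: C_def)
  also have "\<dots> = ennreal \<bar>det L\<bar> * (\<integral>\<^sup>+x. indicator ((*v) L ` C) (L *v x) \<partial>lborel)"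
    using meas by (intro nn_integral_matrix_image[OF det]) (simp add: C_def)
  also have "(\<lambda>x. indicator ((*v) L ` C) (L *v x) :: ennreal) = indicator C"
    using L_inj by (auto simp: fun_eq_iff indicator_def inj_image_mem_iff)
  finally show "emeasure lborel ((*v) L ` {u. \<forall>i. 0 \<le> u $ i \<and> u $ i < 1}) = ennreal \<bar>det L\<bar>"
    using C1 by (simp add: C_def)
qed

text \<open>
  If all nonzero points of \<open>L \<int>\<^sup>d \<inter> w\<^sup>\<bottom>\<close> lay outside the closed unit cube, then by finiteness they
  would lie outside a cube \<open>[-\<rho>, \<rho>]\<^sup>d\<close> with \<open>\<rho> > 1\<close>. Then the cube of side \<open>\<rho>\<close> is packed by these
  points, and the packing bound reads \<open>\<rho>\<^sup>d \<le> \<rho>\<close>, which is absurd for \<open>d \<ge> 2\<close>.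
\<close>

lemma central_section_lattice_point:
  fixes L :: "real ^ 'n ^ 'n" and v w :: "real ^ 'n"
  assumes dim: "CARD('n) \<ge> 2" and "invertible L"
    and v: "v \<in> integer_lattice" "v \<noteq> 0" and w: "\<And>z. w \<bullet> (L *v z) = v \<bullet> z"
    and small: "(det L)\<^sup>2 * (w \<bullet> w) \<le> 1"
  shows "\<exists>z\<in>integer_lattice. z \<noteq> 0 \<and> v \<bullet> z = 0 \<and> L *v z \<in> unit_cube"
proof (rule ccontr)
  assume none: "\<not> ?thesis"
  obtain G where LG: "L ** G = mat 1" and GL: "G ** L = mat 1"
    using \<open>invertible L\<close> by (auto simp: invertible_def)
  have GLx: "G *v (L *v x) = x" and LGx: "L *v (G *v x) = x" for x
    by (simp_all add: matrix_vector_mul_assoc LG GL)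
  define Z where "Z = {z \<in> integer_lattice. z \<noteq> 0 \<and> v \<bullet> z = 0}"
  \<comment> \<open>The bound \<open>2\<close> only serves to make the set finite and nonempty; any number above \<open>1\<close> would do.\<close>
  define T where "T = insert 2 ((\<lambda>z. infnorm (L *v z)) ` {z \<in> Z. infnorm (L *v z) \<le> 2})"
  have "finite {z \<in> Z. infnorm (L *v z) \<le> 2}"
    by (rule finite_subset[OF _ finite_integer_lattice_bounded[OF \<open>invertible L\<close>, of 2]]) (auto simp: Z_def)
  then have T: "finite T" "T \<noteq> {}" "\<forall>t\<in>T. 1 < t"
    using none by (auto simp: T_def Z_def unit_cube_infnorm not_le)
  define \<rho> where "\<rho> = (1 + Min T) / 2"
  have \<rho>: "1 < \<rho>" "\<rho> < Min T"
    using T by (simp_all add: \<rho>_def)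
  have far: "\<rho> < infnorm (L *v z)" if "z \<in> Z" for z
  proof -
    have "Min T \<le> infnorm (L *v z)"
    proof (cases "infnorm (L *v z) \<le> 2")
      case True
      then show ?thesis
        using that T(1) by (intro Min_le) (auto simp: T_def)
    next
      case False
      moreover have "Min T \<le> 2"
        using T(1) by (intro Min_le) (auto simp: T_def)
      ultimately show ?thesis by linarith
    qed
    with \<rho> show ?thesis by linarith
  qed
  have Q: "x \<in> cbox (- ((\<rho> / 2) *\<^sub>R One)) ((\<rho> / 2) *\<^sub>R One) \<Longrightarrow> \<bar>x $ i\<bar> \<le> \<rho> / 2" for x :: "real ^ 'n" and i
    using all_Basis_vec[of "\<lambda>t. \<bar>t\<bar> \<le> \<rho> / 2" x] by (auto simp: mem_box abs_le_iff minus_le_iff)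
  have "((2 * (\<rho> / 2)) ^ DIM(real ^ 'n))\<^sup>2 \<le> \<bar>det L\<bar>\<^sup>2 * (w \<bullet> w) * (2 * (\<rho> / 2))\<^sup>2"
  proof (rule packed_cube_functional_bound)
    show "countable ((*v) L ` integer_lattice)"
      by (intro countable_image countable_integer_lattice)
    show "k - l \<in> (*v) L ` integer_lattice" if "k \<in> (*v) L ` integer_lattice" "l \<in> (*v) L ` integer_lattice" for k l
      using that by (auto simp: matrix_vector_mult_diff_distrib[symmetric] integer_lattice_diff)
    show "(*v) L ` {u. \<forall>i. 0 \<le> u $ i \<and> u $ i < 1} \<in> sets borel"
      "emeasure lborel ((*v) L ` {u. \<forall>i. 0 \<le> u $ i \<and> u $ i < 1}) = ennreal \<bar>det L\<bar>"
      using emeasure_linear_image_unit_cell[OF LG GL] .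
    show "\<exists>!l. l \<in> (*v) L ` integer_lattice \<and> x - l \<in> (*v) L ` {u. \<forall>i. 0 \<le> u $ i \<and> u $ i < 1}" for x
    proof -
      obtain k where k: "k \<in> integer_lattice" "G *v x - k \<in> {u. \<forall>i. 0 \<le> u $ i \<and> u $ i < 1}"
        and uniq: "\<And>m. m \<in> integer_lattice \<Longrightarrow> G *v x - m \<in> {u. \<forall>i. 0 \<le> u $ i \<and> u $ i < 1} \<Longrightarrow> m = k"
        using unit_cell_tiling[of "G *v x"] by blast
      show ?thesis
      proof (rule ex1I[of _ "L *v k"])
        have "x - L *v k = L *v (G *v x - k)"
          by (simp add: matrix_vector_mult_diff_distrib LGx)
        then show "L *v k \<in> (*v) L ` integer_lattice \<and> x - L *v k \<in> (*v) L ` {u. \<forall>i. 0 \<le> u $ i \<and> u $ i < 1}"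
          using k by blast
      next
        fix l assume "l \<in> (*v) L ` integer_lattice \<and> x - l \<in> (*v) L ` {u. \<forall>i. 0 \<le> u $ i \<and> u $ i < 1}"
        then obtain m u where mu: "m \<in> integer_lattice" "l = L *v m" "u \<in> {u. \<forall>i. 0 \<le> u $ i \<and> u $ i < 1}" "x - l = L *v u"
          by blast
        then have "G *v x - m = u"
          by (metis GLx matrix_vector_mult_diff_distrib)
        then show "l = L *v k"
          using uniq[of m] mu by metis
      qed
    qed
    show "0 < \<bar>det L\<bar>"
      using \<open>invertible L\<close> by (simp add: invertible_det_nz)
    show "w \<noteq> 0"
      using w[of v] v by auto
    show "w \<bullet> l \<in> \<int>" if "l \<in> (*v) L ` integer_lattice" for l
      using that v(1) by (auto simp: w inner_integer_lattice)
    show "0 < \<rho> / 2"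
      using \<rho> by simp
    fix x l assume x: "x \<in> cbox (- ((\<rho> / 2) *\<^sub>R One)) ((\<rho> / 2) *\<^sub>R One)" "x + l \<in> cbox (- ((\<rho> / 2) *\<^sub>R One)) ((\<rho> / 2) *\<^sub>R One)"
      and l: "l \<in> (*v) L ` integer_lattice" "w \<bullet> l = 0"
    then obtain z where z: "z \<in> integer_lattice" "l = L *v z" "v \<bullet> z = 0"
      by (auto simp: w)
    have "\<bar>l $ i\<bar> \<le> \<rho>" for i
      using Q[OF x(1), of i] Q[OF x(2), of i] unfolding vector_add_component by linarith
    then have "z \<notin> Z"
      using far[of z] z(2) infnorm_le_iff[of l \<rho>] by force
    then show "l = 0"
      using z by (simp add: Z_def)
  qed
  then have "(\<rho> ^ CARD('n))\<^sup>2 \<le> (det L)\<^sup>2 * (w \<bullet> w) * \<rho>\<^sup>2"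
    by simp
  also have "\<dots> \<le> 1 * \<rho>\<^sup>2"
    using small by (intro mult_right_mono) auto
  finally have "\<rho> ^ CARD('n) \<le> \<rho>"
    using \<rho> by (simp add: power2_le_iff_abs_le)
  moreover have "\<rho> ^ 1 < \<rho> ^ CARD('n)"
    using dim \<rho> by (intro power_strict_increasing) auto
  ultimately show False
    by simp
qed

section \<open>Linear automorphisms of the cube\<close>

lemma cube_preserving_row_sum:
  fixes T :: "real ^ 'n ^ 'n"
  assumes "\<And>x. x \<in> unit_cube \<Longrightarrow> T *v x \<in> unit_cube"
  shows "(\<Sum>j\<in>UNIV. \<bar>T $ i $ j\<bar>) \<le> 1"
proof -
  define x :: "real ^ 'n" where "x = (\<chi> j. sgn (T $ i $ j))"
  have "x \<in> unit_cube"
    by (auto simp: x_def unit_cube_def sgn_if)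
  then have "\<bar>(T *v x) $ i\<bar> \<le> 1"
    using assms by (auto simp: unit_cube_def)
  moreover have "(T *v x) $ i = (\<Sum>j\<in>UNIV. \<bar>T $ i $ j\<bar>)"
    by (simp add: matrix_vector_mult_def x_def abs_sgn)
  ultimately show ?thesis
    by simp
qed

text \<open>
  A linear automorphism of the cube is a signed permutation; only its consequences for the column
  sums and the determinant are recorded. All rows of \<open>T\<close> and \<open>S\<close> have \<open>\<ell>\<^sup>1\<close>-norm at most \<open>1\<close>. As
  \<open>(T ** S) $ i $ i = 1\<close>, column \<open>i\<close> of \<open>S\<close> contains an entry \<open>\<plusminus>1\<close>, which exhausts its row.
  The rows found in this way are distinct, so they are all the rows. The determinant is
  \<open>\<plusminus>1\<close> because the volume of the cube is preserved.
\<close>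

lemma cube_automorphism:
  fixes S T :: "real ^ 'n ^ 'n"
  assumes TS: "T ** S = mat 1"
    and T: "\<And>x. x \<in> unit_cube \<Longrightarrow> T *v x \<in> unit_cube"
    and S: "\<And>x. x \<in> unit_cube \<Longrightarrow> S *v x \<in> unit_cube"
  shows "(\<Sum>j\<in>UNIV. \<bar>S $ j $ i\<bar>) \<le> 1" and "\<bar>det T\<bar> = 1"
proof -
  note rowT = cube_preserving_row_sum[OF T] and rowS = cube_preserving_row_sum[OF S]
  have S1: "\<bar>S $ j $ i\<bar> \<le> 1" for i j
    using rowS[of j] member_le_sum[of i UNIV "\<lambda>i. \<bar>S $ j $ i\<bar>"] by simp
  have "\<exists>j. \<bar>S $ j $ i\<bar> = 1" for i
  proof (rule ccontr)
    assume "\<nexists>j. \<bar>S $ j $ i\<bar> = 1"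
    then have less: "\<bar>S $ j $ i\<bar> < 1" for j
      using S1[of j i] by (metis less_eq_real_def)
    have "1 = (T ** S) $ i $ i"
      by (simp add: TS mat_def)
    also have "\<dots> \<le> (\<Sum>j\<in>UNIV. \<bar>T $ i $ j\<bar> * \<bar>S $ j $ i\<bar>)"
      by (auto simp: matrix_matrix_mult_def abs_mult[symmetric] intro!: sum_mono)
    finally have ge: "1 \<le> (\<Sum>j\<in>UNIV. \<bar>T $ i $ j\<bar> * \<bar>S $ j $ i\<bar>)" .
    then obtain k where "T $ i $ k \<noteq> 0"
      by (force intro: ccontr)
    then have "(\<Sum>j\<in>UNIV. \<bar>T $ i $ j\<bar> * \<bar>S $ j $ i\<bar>) < (\<Sum>j\<in>UNIV. \<bar>T $ i $ j\<bar>)"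
      using less by (intro sum_strict_mono_ex1) (auto simp: mult_left_le less_imp_le intro!: exI[of _ k])
    with ge rowT[of i] show False by linarith
  qed
  then obtain \<sigma> where \<sigma>: "\<bar>S $ \<sigma> i $ i\<bar> = 1" for i
    by metis
  have only: "S $ \<sigma> i $ k = 0" if "k \<noteq> i" for i k
  proof -
    have "(\<Sum>m\<in>{i, k}. \<bar>S $ \<sigma> i $ m\<bar>) \<le> (\<Sum>m\<in>UNIV. \<bar>S $ \<sigma> i $ m\<bar>)"
      by (intro sum_mono2) auto
    with rowS[of "\<sigma> i"] \<sigma>[of i] that show ?thesis by simp
  qed
  have "inj \<sigma>"
  proof (rule injI)
    fix i k assume "\<sigma> i = \<sigma> k"
    then show "i = k"
      using only[of k i] \<sigma>[of k] by fastforce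
  qed
  then have surj: "surj \<sigma>"
    by (simp add: finite_UNIV_inj_surj)
  have "S $ j $ i = 0" if "j \<noteq> \<sigma> i" for j
  proof -
    obtain k where "j = \<sigma> k"
      using surj by blast
    then show ?thesis
      using only[of i k] that by auto
  qed
  then have "(\<Sum>j\<in>UNIV. \<bar>S $ j $ i\<bar>) = (\<Sum>j\<in>UNIV. if j = \<sigma> i then \<bar>S $ j $ i\<bar> else 0)"
    by (intro sum.cong) auto
  then show "(\<Sum>j\<in>UNIV. \<bar>S $ j $ i\<bar>) \<le> 1"
    by (simp add: \<sigma>)
  have cube: "unit_cube = cbox (\<chi> i. -1) ((\<chi> i. 1) :: real ^ 'n)"
    by (simp add: unit_cube_def symmetric_cube_eq_cbox)
  have ST: "S ** T = mat 1"
    using TS by (simp add: matrix_left_right_inverse)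
  have mem: "T *v x \<in> unit_cube \<longleftrightarrow> x \<in> unit_cube" for x
  proof
    assume "T *v x \<in> unit_cube"
    then have "S *v (T *v x) \<in> unit_cube" by (rule S)
    then show "x \<in> unit_cube" by (simp add: matrix_vector_mul_assoc ST)
  qed (rule T)
  have "det T \<noteq> 0"
    using TS ST by (auto simp: invertible_det_nz[symmetric] invertible_def)
  then have "(\<integral>\<^sup>+x. indicator unit_cube (x :: real ^ 'n) \<partial>lborel) = ennreal \<bar>det T\<bar> * (\<integral>\<^sup>+x. indicator unit_cube (T *v x) \<partial>lborel)"
    by (rule nn_integral_matrix_image) (simp add: cube)
  also have "(\<lambda>x. indicator unit_cube (T *v x) :: ennreal) = indicator unit_cube"
    by (simp add: fun_eq_iff indicator_def mem)
  finally have "emeasure lborel (unit_cube :: (real ^ 'n) set) = ennreal \<bar>det T\<bar> * emeasure lborel (unit_cube :: (real ^ 'n) set)"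
    by (simp add: cube)
  moreover have "emeasure lborel (unit_cube :: (real ^ 'n) set) = ennreal (2 ^ CARD('n))"
    unfolding unit_cube_def by (subst emeasure_symmetric_cube) simp_all
  ultimately have "ennreal (2 ^ CARD('n)) = ennreal (\<bar>det T\<bar> * 2 ^ CARD('n))"
    by (simp add: ennreal_mult)
  then have "2 ^ CARD('n) = \<bar>det T\<bar> * 2 ^ CARD('n)"
    by (subst (asm) ennreal_inj) auto
  then show "\<bar>det T\<bar> = 1"
    by simp
qed

section \<open>The pseudo-compound in coordinates\<close>

lemma linear_image_unit_cube:
  assumes "L ** G = mat 1" "G ** L = mat 1"
  shows "(*v) G ` unit_cube = {z. L *v z \<in> unit_cube}"
proof (intro set_eqI iffI)
  fix z assume "z \<in> {z. L *v z \<in> unit_cube}"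
  moreover have "z = G *v (L *v z)"
    using assms by (simp add: matrix_vector_mul_assoc)
  ultimately show "z \<in> (*v) G ` unit_cube"
    by blast
qed (use assms in \<open>auto simp: matrix_vector_mul_assoc\<close>)

lemma form_box_eq_unit_cube_preimage:
  assumes "\<And>i. 0 < c i"
  shows "form_box h c = {z. (\<chi> i j. h i $ j / c i) *v z \<in> unit_cube}"
proof -
  have "((\<chi> i j. h i $ j / c i) *v z) $ i = (h i \<bullet> z) / c i" for z i
    by (simp add: matrix_vector_mult_def inner_vec_def sum_divide_distrib)
  then have "\<bar>h i \<bullet> z\<bar> \<le> c i \<longleftrightarrow> \<bar>((\<chi> i j. h i $ j / c i) *v z) $ i\<bar> \<le> 1" for z i
    using assms[of i] by (simp add: abs_divide)
  then show ?thesis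
    by (simp add: form_box_def unit_cube_def)
qed

text \<open>
  The pseudo-compound expressed through an arbitrary \<open>A\<close> that maps \<open>P\<close> onto the cube: its points
  \<open>v\<close> satisfy \<open>\<bar>v \<bullet> B e\<^sub>i\<bar> \<le> 1 / \<bar>det A\<bar>\<close> with \<open>B\<close> the inverse of \<open>A\<close>. For the matrix \<open>H\<close> with rows
  \<open>h\<^sub>i / \<eta>\<^sub>i\<close> this is the definition, since the inverse of \<open>H\<close> has the columns \<open>\<eta>\<^sub>i h\<^sub>i\<^sup>*\<close> and
  \<open>det H = 1 / \<Prod>\<^sub>j \<eta>\<^sub>j\<close>. It is carried over to \<open>A\<close> by the automorphism \<open>A ** G\<close> of the cube, where
  \<open>G\<close> is the inverse of \<open>H\<close>.
\<close>

lemma pseudo_compound_in_coordinates: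
  fixes P P' :: "(real ^ 'n) set" and A B :: "real ^ 'n ^ 'n"
  assumes compound: "pseudo_compound P P'"
    and A: "A ** B = mat 1" "B ** A = mat 1" and cube: "(*v) A ` P = unit_cube"
  shows "\<exists>F :: real ^ 'n ^ 'n. invertible F \<and> P' = {z. F *v z \<in> unit_cube}"
    and "v \<in> P' \<Longrightarrow> \<bar>(v v* B) $ i\<bar> * \<bar>det A\<bar> \<le> 1"
proof -
  obtain h h' \<eta> where det: "det (\<chi> i. h i) = 1" and \<eta>: "\<And>i. 0 < \<eta> i" and P: "P = form_box h \<eta>"
    and dual: "dual_forms h h'" and P': "P' = form_box h' (\<lambda>i. 1 / \<eta> i * (\<Prod>j\<in>UNIV. \<eta> j))"
    using compound unfolding pseudo_compound_def by blast
  define E where "E = (\<Prod>j\<in>UNIV. \<eta> j)"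
  have E: "0 < E"
    unfolding E_def using \<eta> by (intro prod_pos) auto
  define H where "H = ((\<chi> i j. h i $ j / \<eta> i) :: real ^ 'n ^ 'n)"
  define G where "G = ((\<chi> i j. \<eta> j * h' j $ i) :: real ^ 'n ^ 'n)"
  have "(H ** G) $ i $ j = (\<eta> j / \<eta> i) * (h i \<bullet> h' j)" for i j
    by (simp add: matrix_matrix_mult_def H_def G_def inner_vec_def sum_distrib_left sum_divide_distrib mult_ac)
  then have HG: "H ** G = mat 1"
    using \<eta>[THEN less_imp_neq] dual by (auto simp: vec_eq_iff mat_def dual_forms_def)
  then have GH: "G ** H = mat 1"
    by (simp add: matrix_left_right_inverse)
  have "det H = (\<Prod>i\<in>UNIV. 1 / \<eta> i) * det (\<chi> i. h i)"
  proof -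
    have "H = (\<chi> i. (1 / \<eta> i) *s h i)"
      by (simp add: H_def vec_eq_iff)
    then show ?thesis
      by (simp add: det_rows_mul)
  qed
  then have det_H: "det H = 1 / E"
    by (simp add: det E_def prod_dividef)
  have P_H: "P = {z. H *v z \<in> unit_cube}"
    unfolding P H_def using \<eta> by (rule form_box_eq_unit_cube_preimage)

  define F where "F = ((\<chi> i j. h' i $ j / (1 / \<eta> i * E)) :: real ^ 'n ^ 'n)"
  have "F ** (E *\<^sub>R transpose H) = mat 1"
  proof -
    have "(F ** (E *\<^sub>R transpose H)) $ i $ j = (H ** G) $ j $ i" for i j
      using E by (simp add: matrix_matrix_mult_def F_def H_def G_def transpose_def mult_ac)
    then show ?thesis
      by (simp add: HG vec_eq_iff mat_def eq_commute)
  qed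
  then have "invertible F"
    by (auto simp: invertible_right_inverse)
  moreover have "P' = {z. F *v z \<in> unit_cube}"
    unfolding P' F_def E_def[symmetric] using \<eta> E by (intro form_box_eq_unit_cube_preimage) simp
  ultimately show "\<exists>F :: real ^ 'n ^ 'n. invertible F \<and> P' = {z. F *v z \<in> unit_cube}"
    by (intro exI[of _ F] conjI)

  define T where "T = A ** G"
  define S where "S = H ** B"
  have TS: "T ** S = mat 1"
  proof -
    have "T ** S = A ** (G ** H) ** B"
      by (simp only: T_def S_def matrix_mul_assoc)
    then show ?thesis
      by (simp only: GH A matrix_mul_rid)
  qed
  have T_cube: "T *v x \<in> unit_cube" if "x \<in> unit_cube" for x
  proof -
    have "G *v x \<in> P"
      using that by (simp add: P_H matrix_vector_mul_assoc HG)
    then have "A *v (G *v x) \<in> (*v) A ` P"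
      by (rule imageI)
    then show ?thesis
      by (simp only: cube T_def matrix_vector_mul_assoc)
  qed
  have S_cube: "S *v x \<in> unit_cube" if "x \<in> unit_cube" for x
  proof -
    have "x \<in> (*v) A ` P"
      using that by (simp only: cube)
    then obtain p where p: "p \<in> P" "x = A *v p"
      by (rule imageE)
    have "S *v x = H *v ((B ** A) *v p)"
      by (simp only: p(2) S_def matrix_vector_mul_assoc matrix_mul_assoc)
    then show ?thesis
      using p(1) by (simp add: A P_H)
  qed
  note automorphism = cube_automorphism[OF TS T_cube S_cube]
  have "A = T ** H"
    by (simp only: T_def matrix_mul_assoc[symmetric] GH matrix_mul_rid)
  then have det_A: "\<bar>det A\<bar> = 1 / E"
    using automorphism(2) E by (simp add: det_mul abs_mult det_H)

  assume v: "v \<in> P'"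
  have vG: "\<bar>(v v* G) $ j\<bar> \<le> E" for j
  proof -
    have "(v v* G) $ j = \<eta> j * (h' j \<bullet> v)"
      by (simp add: vector_matrix_mult_def G_def inner_vec_def sum_distrib_left mult_ac)
    moreover have "\<bar>h' j \<bullet> v\<bar> \<le> 1 / \<eta> j * E"
      using v unfolding P' form_box_def E_def by blast
    ultimately show ?thesis
      using \<eta>[of j] by (simp add: abs_mult field_simps)
  qed
  have "B = G ** S"
    by (simp only: S_def matrix_mul_assoc GH matrix_mul_lid)
  then have "(v v* B) $ i = (\<Sum>j\<in>UNIV. (v v* G) $ j * S $ j $ i)"
    by (simp add: vector_matrix_mul_assoc[symmetric]) (simp add: vector_matrix_mult_def mult.commute)
  then have "\<bar>(v v* B) $ i\<bar> \<le> (\<Sum>j\<in>UNIV. \<bar>(v v* G) $ j * S $ j $ i\<bar>)"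
    by simp
  also have "\<dots> \<le> (\<Sum>j\<in>UNIV. E * \<bar>S $ j $ i\<bar>)"
    by (intro sum_mono) (simp add: abs_mult mult_right_mono vG)
  also have "\<dots> \<le> E * 1"
    unfolding sum_distrib_left[symmetric] using automorphism(1) E by (intro mult_left_mono) auto
  finally show "\<bar>(v v* B) $ i\<bar> * \<bar>det A\<bar> \<le> 1"
    using E by (simp add: det_A)
qed

section \<open>The transference theorem\<close>

theorem theorem4:
  fixes P P' :: "(real ^ 'n) set" and A :: "real ^ 'n ^ 'n" and \<tau> :: "real ^ 'n"
  assumes "CARD('n) \<ge> 2"
    and "symmetric_parallelepiped P"
    and "pseudo_compound P P'"
    and "invertible A" and "(*v) A ` P = unit_cube"
    and "\<forall>i. \<tau> $ i > 0"
    and "(\<Sum>i\<in>UNIV. (\<tau> $ i)\<^sup>2) = (\<Prod>i\<in>UNIV. (\<tau> $ i)\<^sup>2)"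
    and "successive_minimum 1 P' integer_lattice \<le> 1"
  shows "successive_minimum 1 ((*v) (H_op A \<tau>) ` P) integer_lattice \<le> 1"
proof -
  define B where "B = matrix_inv A"
  have AB: "A ** B = mat 1" and BA: "B ** A = mat 1"
    using \<open>invertible A\<close> someI_ex[of "\<lambda>B. A ** B = mat 1 \<and> B ** A = mat 1"]
    unfolding B_def matrix_inv_def invertible_def by blast+
  note coordinates = pseudo_compound_in_coordinates[OF \<open>pseudo_compound P P'\<close> AB BA \<open>(*v) A ` P = unit_cube\<close>]
  obtain v where v: "v \<in> integer_lattice" "v \<noteq> 0" "v \<in> P'"
    using coordinates(1) assms(8) successive_minimum_1_le_1_iff by blast

  define L where "L = diagonal_matrix (\<chi> i. 1 / \<tau> $ i) ** A"
  define G where "G = B ** diagonal_matrix \<tau>"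
  define W where "W = (\<Prod>i\<in>UNIV. \<tau> $ i)"
  have \<tau>: "\<tau> $ i \<noteq> 0" for i
    using assms(6)[rule_format, of i] by simp
  have diag: "diagonal_matrix t *v x = (\<chi> i. t $ i * x $ i)" for t x :: "real ^ 'n"
  proof -
    have "(diagonal_matrix t *v x) $ i = t $ i * x $ i" for i
      by (subst matrix_vector_mult_single_entry[of i]) (auto simp: diagonal_matrix_def)
    then show ?thesis by (simp add: vec_eq_iff)
  qed
  have LG: "L ** G = mat 1" and GL: "G ** L = mat 1"
  proof -
    have "G *v (L *v x) = B *v (A *v x)" for x
      using \<tau> by (simp add: L_def G_def matrix_vector_mul_assoc[symmetric] diag)
    then show "G ** L = mat 1"
      by (simp add: matrix_eq matrix_vector_mul_assoc BA)
    then show "L ** G = mat 1"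
      by (simp add: matrix_left_right_inverse)
  qed
  have body: "(*v) (H_op A \<tau>) ` P = {z. L *v z \<in> unit_cube}"
  proof -
    have "(*v) (H_op A \<tau>) ` P = (*v) G ` ((*v) A ` P)"
      by (simp add: H_op_def G_def B_def image_image matrix_vector_mul_assoc matrix_mul_assoc)
    then show ?thesis
      by (simp add: assms(5) linear_image_unit_cube[OF LG GL])
  qed

  have det_L: "det L = det A / W"
    by (simp add: L_def det_mul det_diagonal diagonal_matrix_def W_def prod_dividef)
  \<comment> \<open>\<open>w\<close> is the form \<open>v\<close> in the coordinates \<open>L z\<close>\<close>
  define w where "w = v v* G"
  have w_i: "w $ i = \<tau> $ i * (v v* B) $ i" for i
  proof -
    have "w $ i = (\<Sum>j\<in>UNIV. (v v* B) $ j * diagonal_matrix \<tau> $ j $ i)"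
      by (simp add: w_def G_def vector_matrix_mul_assoc[symmetric]) (simp add: vector_matrix_mult_def mult.commute)
    also have "\<dots> = (\<Sum>j\<in>UNIV. if j = i then (v v* B) $ i * \<tau> $ i else 0)"
      by (rule sum.cong) (auto simp: diagonal_matrix_def)
    finally show ?thesis by (simp add: mult.commute)
  qed
  have "W \<noteq> 0" and W: "W\<^sup>2 = (\<Sum>i\<in>UNIV. (\<tau> $ i)\<^sup>2)"
    using \<tau> assms(7) by (simp_all add: W_def prod_power_distrib)
  have "(det A)\<^sup>2 * (w \<bullet> w) = (\<Sum>i\<in>UNIV. (\<tau> $ i)\<^sup>2 * (\<bar>(v v* B) $ i\<bar> * \<bar>det A\<bar>)\<^sup>2)"
  proof -
    have "w \<bullet> w = (\<Sum>i\<in>UNIV. (\<tau> $ i)\<^sup>2 * ((v v* B) $ i)\<^sup>2)"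
      by (simp add: inner_vec_def w_i power2_eq_square mult_ac)
    then show ?thesis
      by (simp add: sum_distrib_left power_mult_distrib mult_ac)
  qed
  also have "\<dots> \<le> (\<Sum>i\<in>UNIV. (\<tau> $ i)\<^sup>2 * 1)"
    using coordinates(2)[OF v(3)] by (intro sum_mono mult_left_mono power_le_one) auto
  \<comment> \<open>the condition on \<open>\<tau>\<close> enters here, as \<open>W\<^sup>2 = \<Sum> \<tau>\<^sub>i\<^sup>2\<close>\<close>
  finally have small: "(det L)\<^sup>2 * (w \<bullet> w) \<le> 1"
    using \<open>W \<noteq> 0\<close> by (simp add: det_L W[symmetric] power_divide)
  have dot: "w \<bullet> (L *v z) = v \<bullet> z" for z
    by (simp add: w_def dot_lmul_matrix matrix_vector_mul_assoc GL)
  have "invertible L"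
    using LG GL by (auto simp: invertible_def)
  then show ?thesis
    using central_section_lattice_point[OF assms(1) \<open>invertible L\<close> v(1,2) dot small]
    unfolding body successive_minimum_1_le_1_iff[OF \<open>invertible L\<close>] by blast
qed

end
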